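(* Let $1\leq i\leq k_0$, let $\sigma\in T$, and let $\tau = X^{k}\prod_{j=1}^{n}\mathcal{I}_{a_j}(\tau_j)\in T$ with $k\in\mathbb{N}^{d+1}$, decorated trees $\tau_1,\dots,\tau_n$, and $a_j=(\mathfrak{t}^+_{l_j},k_j)\in\mathfrak{T}^+\times\mathbb{N}^{d+1}$. Then $$ F_i\bigg(\Big\{X^{k}\prod_{j=1}^{n}\mathcal{I}_{a_j}(\tau_j)\Big\}\star\sigma\bigg) = \Big(\partial^k D_{a_1}\cdots D_{a_n}F_i(\sigma)\Big)\,\prod_{j=1}^n F_{l_j}(\tau_j). $$
   Context: **Decorated trees.** Fix integers $d,n_0,k_0\ge 1$, a finite set of noise types $\mathfrak{T}^-=\{\mathfrak{t}^-_1,\dots,\mathfrak{t}^-_{n_0}\}$ and a finite set of operator types $\mathfrak{T}^+=\{\mathfrak{t}_1^+,\dots,\mathfrak{t}_{k_0}^+\}$. Decorated trees are non-planar rooted trees with a decoration $\mathfrak{n}_v\in\mathbb{N}^{d+1}$ at each node $v$, each edge being decorated by an element $(\mathfrak{t},p)$ of $\mathfrak{T}^+\times\mathbb{N}^{d+1}$, and with at most one noise attached to each node. A noise of type $\mathfrak{t}_l^-$ attached to a node (an edge of noise type leading directly to a leaf) is denoted by the symbol $\zeta_l$, $1\le l\le n_0$; the leaf of a noise edge is not counted as a node of the tree. By convention $\zeta_0=\mathbf{1}$ (no noise). Write $N_\tau$ for the node set of $\tau$. For $a\in\mathfrak{T}^+\times\mathbb{N}^{d+1}$, $\mathcal{I}_a(\tau)$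 is the tree obtained by grafting $\tau$ onto a new undecorated root via an edge decorated by $a$; $X^k$ is the single node decorated by $k$; $X^0=\mathbf{1}$. Every decorated tree has a unique decomposition (up to reordering) $\tau=X^k\zeta_l\prod_{j=1}^n\mathcal{I}_{a_j}(\tau_j)$ with $0\le l\le n_0$, $a_j\in\mathfrak{T}^+\times\mathbb{N}^{d+1}$, the product being the tree product (identification of roots). $T$ is the real linear span of all decorated trees. **Product $\star$.** For $a=(\mathfrak{t},p)$ and $m\in\mathbb{N}^{d+1}$ write $a-m=(\mathfrak{t},p-m)$ and $a+m=(\mathfrak{t},p+m)$; a tree having an edge decoration $(\mathfrak{t},p-m)$ with $p-m\notin\mathbb{N}^{d+1}$ is set to $0$. For decorated trees $\sigma_1,\dots,\sigma_n,\tau$ and $a_i\in\mathfrak{T}^+\times\mathbb{N}^{d+1}$, $$\prod_{i=1}^n\mathcal{I}_{a_i}(\sigma_i)\curvearrowright\tau:=\sum_{v_1,\dots,v_n\in N_\tau}\ \sum_{m_1,\dots,m_n\in\mathbb{N}^{d+1}}\ \prod_{v\in N_\tau}\frac{\mathfrak{n}_v!}{\big(\mathfrak{n}_v-\sum_{i:v_i=v}m_i\big)!\prod_{i:v_i=v}m_i!}\ \tau_{v,m},$$ where $\tau_{v,m}$ is obtained from $\tau$ by replacing the decoration $\mathfrak{n}_v$ of each node $v$ of $\tau$ by $\mathfrak{n}_v-\sum_{i:v_i=v}m_i$ and grafting each $\sigma_i$ onto the node $v_i$ with an edge decorated by $a_i-m_i$ (terms with $\sum_{i:v_i=v}m_i\not\le\mathfrak{n}_v$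 for some $v$ are zero). For $B\subset N_\tau$, $\uparrow^k_{B}$ adds $k_v\in\mathbb{N}^{d+1}$ to the decoration of each $v\in B$ and sums over all families $(k_v)_{v\in B}$ with $\sum_v k_v=k$, as the expansion of the $k$-th power of a derivation: $\uparrow_B^k=\prod_{r=1}^{d+1}\big(\sum_{v\in B}\uparrow_v^{e_r}\big)^{k_r}$, where $\uparrow_v^{e_r}$ adds $e_r$ to the decoration at $v$ and $(e_r)$ is the canonical basis. For $\sigma=X^k\prod_i\mathcal{I}_{a_i}(\sigma_i)$ with $a_i\in\mathfrak{T}^+\times\mathbb{N}^{d+1}$, $$\sigma\star\tau:=\ \uparrow^k_{N_\tau}\Big(\prod_i\mathcal{I}_{a_i}(\sigma_i)\curvearrowright\tau\Big),$$ where $\uparrow^k_{N_\tau}$ acts only on the nodes coming from $\tau$ (not those of the $\sigma_i$); extended bilinearly. **The functions $F_i$.** Let $(Z_a)$ be variables indexed by $a\in\mathfrak{T}^+\times\mathbb{N}^{d+1}$, and let $(F_i^l)_{1\le i\le k_0,\,0\le l\le n_0}$ be given smooth functions, each of finitely many of these variables. $D_a$ is the partial derivative in $Z_a$; set $\partial_r:=\sum_a Z_{a+e_r}D_a$ for $1\le r\le d+1$ and $\partial^k:=\partial_1^{k_1}\cdots\partial_{d+1}^{k_{d+1}}$. (If $Z_{(\mathfrak{t}_j^+,p)}$ and $F_j^l$ are vector-valued, in $\mathbb{R}^{d_j}$, products of derivatives with such quantities are understood as evaluation of the corresponding multilinear maps.) Define inductively, for $1\le i\le k_0$ and $\tau=X^k\zeta_l\prod_{j=1}^n\mathcal{I}_{a_j}(\tau_j)$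 with $a_j=(\mathfrak{t}^+_{l_j},k_j)$, $$F_i(\zeta_l):=F_i^l,\qquad F_i(\tau):=\Big(\partial^kD_{a_1}\cdots D_{a_n}F_i(\zeta_l)\Big)\prod_{j=1}^nF_{l_j}(\tau_j),$$ and extend $F_i$ linearly to $T$. *)

theory Defs
  imports "HOL-Analysis.Analysis" "HOL-Library.Poly_Mapping"
begin

text \<open>
  The index set \<open>{1,\<dots>,d+1}\<close> is a finite linearly ordered type \<open>'d\<close> with at least two elements,
  and \<open>'d midx\<close> is the set of multi-indices, with componentwise \<open>+\<close>, \<open>-\<close> (truncated) and \<open>\<le>\<close>.
  The canonical basis vector with index \<open>r\<close> is \<open>axis r 1\<close>.
  The finite nonempty types \<open>'n\<close> and \<open>'k\<close> are the noise types and the operator types.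
\<close>

type_synonym 'd midx = "(nat, 'd) vec"

definition mfact :: "'d::finite midx \<Rightarrow> real"
  where "mfact k = (\<Prod>r\<in>UNIV. fact (k $ r))"

text \<open>The ordered composition \<open>A\<^sub>1\<^bsup>k\<^sub>1\<^esup> \<circ> \<cdots> \<circ> A\<^sub>d\<^sub>+\<^sub>1\<^bsup>k\<^sub>d\<^sub>+\<^sub>1\<^esup>\<close>.\<close>

definition multi_power :: "('d::{finite,linorder} \<Rightarrow> 'b \<Rightarrow> 'b) \<Rightarrow> 'd midx \<Rightarrow> 'b \<Rightarrow> 'b"
  where "multi_power A k = foldr (\<lambda>r f. (A r ^^ (k $ r)) \<circ> f) (sorted_list_of_set UNIV) id"

definition lin_ext :: "('a \<Rightarrow> 'b \<Rightarrow>\<^sub>0 real) \<Rightarrow> ('a \<Rightarrow>\<^sub>0 real) \<Rightarrow> 'b \<Rightarrow>\<^sub>0 real"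
  where "lin_ext f x =
    (\<Sum>a\<in>Poly_Mapping.keys x. Poly_Mapping.map ((*) (Poly_Mapping.lookup x a)) (f a))"

text \<open>
  Some enumeration of a finite multiset; it is only used for operations that do not depend on
  the order (for derivatives: on smooth functions).
\<close>

definition enum_mset :: "'a multiset \<Rightarrow> 'a list"
  where "enum_mset M = (SOME xs. mset xs = M)"

lemma mset_enum_mset [simp]: "mset (enum_mset M) = M"
  unfolding enum_mset_def by (rule someI_ex, rule ex_mset)

text \<open>
  Non-planar rooted trees: \<open>Node x l M\<close> has root label \<open>x\<close>, an optional noise at the root
  (\<open>None\<close> being \<open>\<zeta>\<^sub>0 = \<one>\<close>), and \<open>M\<close> is the multiset of the branches, each given by the decoration of
  its edge and the subtree above it. With labels in \<open>'d midx\<close> this is the decomposition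
  \<open>X\<^sup>k \<zeta>\<^sub>l \<Prod>\<^sub>j \<I>\<^bsub>a\<^sub>j\<^esub>(\<tau>\<^sub>j)\<close>, unique up to reordering. Other label types are used to name the nodes.
\<close>

datatype (nodes: 'a, dead 'n, dead 'e) tree =
  Node 'a "'n option" "('e \<times> ('a, 'n, 'e) tree) multiset"
for map: relabel

type_synonym ('k, 'd) edge = "'k \<times> 'd midx"

type_synonym ('d, 'n, 'k) dtree = "('d midx, 'n, ('k, 'd) edge) tree"

primrec node_mset :: "('a, 'n, 'e) tree \<Rightarrow> 'a multiset"
  where "node_mset (Node x l M) = {#x#} + (\<Sum>\<^sub># (image_mset snd (image_mset (map_prod id node_mset) M)))"

text \<open>
  A decorated tree \<open>\<tau>\<close> is presented as a tree \<open>s\<close> with pairwise distinct node names together with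
  a decoration \<open>\<nn>\<close> of the names, \<open>\<tau> = relabel \<nn> s\<close>. Then \<open>N\<^sub>\<tau> = nodes s\<close>.
\<close>

definition presents ::
    "(nat, 'n, 'e) tree \<Rightarrow> (nat \<Rightarrow> 'b) \<Rightarrow> ('b, 'n, 'e) tree \<Rightarrow> bool"
  where "presents s \<nn> \<tau> \<longleftrightarrow> (\<forall>v. count (node_mset s) v \<le> 1) \<and> relabel \<nn> s = \<tau>"

lemma set_node_mset [simp]: "set_mset (node_mset t) = nodes t"
  by (induction t) (fastforce simp: Basic_BNFs.snds.simps)

lemma ex_presents: "\<exists>s \<nn>. presents s \<nn> \<tau>"
proof -
  have "\<forall>n. \<exists>s \<nn>. presents s \<nn> \<tau> \<and> (\<forall>v\<in>nodes s. n \<le> v)"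
  proof (induction \<tau>)
    case (Node x l M)
    let ?L = "\<lambda>M'. \<Sum>\<^sub># (image_mset (\<lambda>b. node_mset (snd b)) M')"
    have M: "\<exists>M' \<nn>. image_mset (map_prod id (relabel \<nn>)) M' = M \<and>
      (\<forall>v. count (?L M') v \<le> 1) \<and> (\<forall>v\<in>#?L M'. n \<le> v)" for n :: nat
      using Node.IH
    proof (induction M)
      case empty
      show ?case by (rule exI[of _ "{#}"]) auto
    next
      case (add b M)
      obtain M' \<nn> where 1: "image_mset (map_prod id (relabel \<nn>)) M' = M"
        "\<forall>v. count (?L M') v \<le> 1" "\<forall>v\<in>#?L M'. n \<le> v"
        using add by (metis union_iff add_mset_add_single)
      define N where "N = n + Suc (Max (insert 0 (set_mset (?L M'))))"
      have N: "v < N" if "v \<in># ?L M'" for v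
        unfolding N_def using that by (simp add: less_Suc_eq_le trans_le_add2)
      obtain s \<mm> where 2: "presents s \<mm> (snd b)" "\<forall>v\<in>nodes s. N \<le> v"
        using add.prems[of b "snd b"] by (cases b) (simp, blast)
      define \<kk> where "\<kk> v = (if v < N then \<nn> v else \<mm> v)" for v
      have a: "relabel \<kk> s = snd b"
      proof -
        have "relabel \<kk> s = relabel \<mm> s"
          by (rule tree.map_cong0) (use 2(2) in \<open>auto simp: \<kk>_def\<close>)
        then show ?thesis using 2(1) by (simp add: presents_def)
      qed
      have b: "image_mset (map_prod id (relabel \<kk>)) M' = M"
      proof -
        have "map_prod id (relabel \<kk>) q = map_prod id (relabel \<nn>) q" if "q \<in># M'" for q
        proof -
          have "relabel \<kk> (snd q) = relabel \<nn> (snd q)"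
            by (rule tree.map_cong0) (use N that in \<open>auto simp: \<kk>_def\<close>)
          then show ?thesis by (cases q) auto
        qed
        then show ?thesis using 1(1) by (metis image_mset_cong)
      qed
      have c: "count (node_mset s + ?L M') v \<le> 1" for v
      proof (cases "v < N")
        case True
        then have "count (node_mset s) v = 0"
          using 2(2) by (auto simp: count_eq_zero_iff)
        then show ?thesis using 1(2) by simp
      next
        case False
        then have "count (?L M') v = 0" using N by (meson count_eq_zero_iff)
        then show ?thesis using 2(1) by (simp add: presents_def)
      qed
      have nN: "n \<le> N" by (simp add: N_def)
      show ?case
        by (rule exI[of _ "add_mset (fst b, s) M'"], rule exI[of _ \<kk>])
          (use a b c 1(3) 2(2) nN in \<open>auto simp: id_def\<close>)
    qed
    show ?case
    proof
      fix n
      obtain M' \<nn> where 1: "image_mset (map_prod id (relabel \<nn>)) M' = M"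
        "\<forall>v. count (?L M') v \<le> 1" "\<forall>v\<in>#?L M'. Suc n \<le> v"
        using M[of "Suc n"] by blast
      have c0: "count (?L M') n = 0" using 1(3) by (meson count_eq_zero_iff not_less_eq_eq order_refl)
      have rel: "map_prod id (relabel (\<nn>(n := x))) q = map_prod id (relabel \<nn>) q" if "q \<in># M'" for q
      proof -
        have "relabel (\<nn>(n := x)) (snd q) = relabel \<nn> (snd q)"
          by (rule tree.map_cong0) (use 1(3) that in \<open>force\<close>)
        then show ?thesis by (cases q) auto
      qed
      have im: "image_mset (map_prod id (relabel (\<nn>(n := x)))) M' = M"
        using rel 1(1) by (metis image_mset_cong)
      have L: "node_mset (Node n l M') = add_mset n (?L M')"
        by (simp add: multiset.map_comp comp_def)
      have "presents (Node n l M') (\<nn>(n := x)) (Node x l M)"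
        unfolding presents_def L using im 1(2) c0 by simp
      moreover have "\<forall>v\<in>nodes (Node n l M'). n \<le> v"
        unfolding set_node_mset[symmetric] L using 1(3) by (auto, metis Suc_leD snd_conv)
      ultimately show "\<exists>s \<nn>. presents s \<nn> (Node x l M) \<and> (\<forall>v\<in>nodes s. n \<le> v)" by blast
    qed
  qed
  then show ?thesis by blast
qed

text \<open>Relabels every node \<open>v\<close> by \<open>h v\<close> and grafts the branches \<open>g v\<close> onto it.\<close>

primrec decorate_graft ::
    "('a \<Rightarrow> 'b) \<Rightarrow> ('a \<Rightarrow> ('e \<times> ('b, 'n, 'e) tree) multiset) \<Rightarrow> ('a, 'n, 'e) tree \<Rightarrow> ('b, 'n, 'e) tree"
  where "decorate_graft h g (Node v l M) =
    Node (h v) l (image_mset (map_prod id (decorate_graft h g)) M + g v)"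

text \<open>
  In the grafting sum every node of the resulting trees carries, besides its decoration, the mark
  \<open>Some w\<close> if it is the node \<open>w\<close> of the lower tree, and \<open>None\<close> if it comes from one of the grafted trees.
\<close>

type_synonym ('d, 'n, 'k) marked_tree = "(nat option \<times> 'd midx, 'n, ('k, 'd) edge) tree"

definition grafted ::
    "(('k, 'd::finite) edge \<times> ('d, 'n, 'k) dtree) list \<Rightarrow> (nat, 'n, ('k, 'd) edge) tree \<Rightarrow>
     (nat \<Rightarrow> 'd midx) \<Rightarrow> (nat \<Rightarrow> nat) \<Rightarrow> (nat \<Rightarrow> 'd midx) \<Rightarrow> ('d, 'n, 'k) marked_tree"
  where "grafted bs s \<nn> v m = decorate_graft
    (\<lambda>w. (Some w, \<nn> w - (\<Sum>i | i < length bs \<and> v i = w. m i)))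
    (\<lambda>w. image_mset
       (\<lambda>i. case bs ! i of ((t, p), \<sigma>) \<Rightarrow> ((t, p - m i), relabel (\<lambda>k. (None, k)) \<sigma>))
       (mset_set {i. i < length bs \<and> v i = w}))
    s"

text \<open>
  The families \<open>m\<close> are restricted to the finite set on which the multinomial coefficients do not
  vanish; trees with an edge decoration outside of the multi-indices are zero.
\<close>

definition graft ::
    "(('k, 'd::finite) edge \<times> ('d, 'n, 'k) dtree) list \<Rightarrow> (nat, 'n, ('k, 'd) edge) tree \<Rightarrow>
     (nat \<Rightarrow> 'd midx) \<Rightarrow> ('d, 'n, 'k) marked_tree \<Rightarrow>\<^sub>0 real"
  where "graft bs s \<nn> =
    (\<Sum>v \<in> {..<length bs} \<rightarrow>\<^sub>E nodes s.
     \<Sum>m \<in> {m \<in> {..<length bs} \<rightarrow>\<^sub>E UNIV.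
             \<forall>w\<in>nodes s. (\<Sum>i | i < length bs \<and> v i = w. m i) \<le> \<nn> w}.
       if \<forall>i<length bs. m i \<le> snd (fst (bs ! i))
       then Poly_Mapping.single (grafted bs s \<nn> v m)
         (\<Prod>w\<in>nodes s. mfact (\<nn> w) /
            (mfact (\<nn> w - (\<Sum>i | i < length bs \<and> v i = w. m i)) *
             (\<Prod>i | i < length bs \<and> v i = w. mfact (m i))))
       else 0)"

definition raise ::
    "nat set \<Rightarrow> 'd::finite \<Rightarrow>
     (('d, 'n, 'k) marked_tree \<Rightarrow>\<^sub>0 real) \<Rightarrow> ('d, 'n, 'k) marked_tree \<Rightarrow>\<^sub>0 real"
  where "raise B r = lin_ext (\<lambda>t. \<Sum>w\<in>B. Poly_Mapping.single
    (relabel (\<lambda>(u, k). (u, if u = Some w then k + axis r 1 else k)) t) 1)"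

text \<open>
  The left factor has no noise at its root; the value in the other case is a dummy.
  The result does not depend on the chosen presentation of the right factor.
\<close>

fun star_tree :: "('d::{finite,linorder}, 'n, 'k) dtree \<Rightarrow> ('d, 'n, 'k) dtree \<Rightarrow> ('d, 'n, 'k) dtree \<Rightarrow>\<^sub>0 real"
  where
    "star_tree (Node k None M) \<tau> =
      (let (s, \<nn>) = (SOME (s, \<nn>). presents s \<nn> \<tau>)
       in lin_ext (\<lambda>t. Poly_Mapping.single (relabel snd t) 1)
            (multi_power (raise (nodes s)) k (graft (enum_mset M) s \<nn>)))"
  | "star_tree (Node k (Some l) M) \<tau> = 0"

definition star ::
    "(('d::{finite,linorder}, 'n, 'k) dtree \<Rightarrow>\<^sub>0 real) \<Rightarrow> (('d, 'n, 'k) dtree \<Rightarrow>\<^sub>0 real) \<Rightarrow>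
     ('d, 'n, 'k) dtree \<Rightarrow>\<^sub>0 real"  (infixl \<open>\<star>\<close> 70)
  where "x \<star> y = lin_ext (\<lambda>\<sigma>. lin_ext (star_tree \<sigma>) y) x"

text \<open>
  The variable \<open>Z\<^sub>a\<close> with \<open>a = (j, p)\<close> takes values in \<open>\<real>\<^bsup>dm j\<^esup>\<close>, its components being \<open>Z a c\<close> for
  \<open>c < dm j\<close>; likewise for the components of \<open>\<real>\<^bsup>dm j\<^esup>\<close>-valued functions. The scalar case is \<open>dm j = 1\<close>.
\<close>

type_synonym ('k, 'd) point = "('k, 'd) edge \<Rightarrow> nat \<Rightarrow> real"

definition partial ::
    "('k, 'd::finite) edge \<Rightarrow> nat \<Rightarrow> (('k, 'd) point \<Rightarrow> real) \<Rightarrow> ('k, 'd) point \<Rightarrow> real"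
  where "partial a c G Z = deriv (\<lambda>x. G (Z(a := (Z a)(c := x)))) (Z a c)"

primrec Ck :: "nat \<Rightarrow> (('k, 'd::finite) point \<Rightarrow> real) \<Rightarrow> bool"
  where
    "Ck 0 G \<longleftrightarrow> continuous_on UNIV G"
  | "Ck (Suc n) G \<longleftrightarrow> continuous_on UNIV G \<and>
      (\<forall>a c. (\<forall>Z. (\<lambda>x. G (Z(a := (Z a)(c := x)))) field_differentiable at (Z a c)) \<and>
             Ck n (partial a c G))"

definition smooth :: "(('k, 'd::finite) point \<Rightarrow> real) \<Rightarrow> bool"
  where "smooth G \<longleftrightarrow> (\<forall>n. Ck n G)"

definition finitely_many_vars :: "('k \<Rightarrow> nat) \<Rightarrow> (('k, 'd::finite) point \<Rightarrow> real) \<Rightarrow> bool"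
  where "finitely_many_vars dm G \<longleftrightarrow>
    (\<exists>S. finite S \<and> S \<subseteq> {(a, c). c < dm (fst a)} \<and>
         (\<forall>Z Z'. (\<forall>(a, c)\<in>S. Z a c = Z' a c) \<longrightarrow> G Z = G Z'))"

definition total_deriv ::
    "('k \<Rightarrow> nat) \<Rightarrow> 'd::finite \<Rightarrow> (('k, 'd) point \<Rightarrow> real) \<Rightarrow> ('k, 'd) point \<Rightarrow> real"
  where "total_deriv dm r G Z =
    Sum_any (\<lambda>a. \<Sum>c<dm (fst a). Z (fst a, snd a + axis r 1) c * partial a c G Z)"

text \<open>
  For \<open>avs = [(a\<^sub>1, v\<^sub>1), \<dots>, (a\<^sub>n, v\<^sub>n)]\<close> with vector-valued functions \<open>v\<^sub>j\<close>, this is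
  \<open>(\<partial>\<^sup>k D\<^bsub>a\<^sub>1\<^esub> \<cdots> D\<^bsub>a\<^sub>n\<^esub> G) \<Prod>\<^sub>j v\<^sub>j\<close>, the evaluation of a multilinear map, written in components.
\<close>

definition deriv_eval ::
    "('k \<Rightarrow> nat) \<Rightarrow> 'd::{finite,linorder} midx \<Rightarrow>
     (('k, 'd) edge \<times> (nat \<Rightarrow> ('k, 'd) point \<Rightarrow> real)) list \<Rightarrow>
     (('k, 'd) point \<Rightarrow> real) \<Rightarrow> ('k, 'd) point \<Rightarrow> real"
  where "deriv_eval dm k avs G Z =
    (\<Sum>c \<in> (\<Pi>\<^sub>E j\<in>{..<length avs}. {..<dm (fst (fst (avs ! j)))}).
       multi_power (total_deriv dm) k
         (foldr (\<lambda>j. partial (fst (avs ! j)) (c j)) [0..<length avs] G) Z *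
       (\<Prod>j<length avs. snd (avs ! j) (c j) Z))"

text \<open>\<open>elem_diff dm F \<tau> i c\<close> is the component \<open>c\<close> of \<open>F\<^sub>i(\<tau>)\<close>, where \<open>F i l\<close> is \<open>F\<^sub>i\<^sup>l\<close>.\<close>

primrec elem_diff ::
    "('k \<Rightarrow> nat) \<Rightarrow> ('k \<Rightarrow> 'n option \<Rightarrow> nat \<Rightarrow> ('k, 'd::{finite,linorder}) point \<Rightarrow> real) \<Rightarrow>
     ('d, 'n, 'k) dtree \<Rightarrow> 'k \<Rightarrow> nat \<Rightarrow> ('k, 'd) point \<Rightarrow> real"
  where "elem_diff dm F (Node k l M) = (\<lambda>i c.
    deriv_eval dm k
      (map (\<lambda>(a, f). (a, f (fst a))) (enum_mset (image_mset (map_prod id (elem_diff dm F)) M)))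
      (F i l c))"

definition elem_diff_lin ::
    "('k \<Rightarrow> nat) \<Rightarrow> ('k \<Rightarrow> 'n option \<Rightarrow> nat \<Rightarrow> ('k, 'd::{finite,linorder}) point \<Rightarrow> real) \<Rightarrow>
     (('d, 'n, 'k) dtree \<Rightarrow>\<^sub>0 real) \<Rightarrow> 'k \<Rightarrow> nat \<Rightarrow> ('k, 'd) point \<Rightarrow> real"
  where "elem_diff_lin dm F x i c Z =
    (\<Sum>\<tau>\<in>Poly_Mapping.keys x. Poly_Mapping.lookup x \<tau> * elem_diff dm F \<tau> i c Z)"

end

theory Submission
  imports Defs
begin

text \<open>
  Freeze a point \<open>Z\<close> and the values \<open>F\<^bsub>l\<^sub>j\<^esub>(\<tau>\<^sub>j)(Z)\<close>. Then \<open>D\<^bsub>a\<^sub>j\<^esub>\<close>, evaluated at these values, becomes a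
  derivation \<open>\<D>\<^sub>j\<close> with constant coefficients, and the right-hand side is
  \<open>\<partial>\<^sup>k \<D>\<^sub>1 \<cdots> \<D>\<^sub>n F\<^sub>i(\<sigma>)\<close> at \<open>Z\<close>. By the Leibniz rule a derivation acts on \<open>F\<^sub>i(\<sigma>)\<close> as the sum, over the
  nodes of \<open>\<sigma>\<close>, of its action on the operator \<open>\<partial>\<^bsup>\<nn>\<^sub>v\<^esup>\<close> sitting at the node. For \<open>\<partial>\<^sub>r\<close> this raises the
  decoration of the node. For \<open>\<D>\<^sub>a\<close> it grafts, since \<open>\<D>\<^sub>a \<partial>\<^sub>r = \<partial>\<^sub>r \<D>\<^sub>a + \<D>\<^bsub>a - e\<^sub>r\<^esub>\<close> gives
  \<open>\<D>\<^sub>a \<partial>\<^bsup>\<nn>\<^esup> = \<Sum>\<^sub>m (\<nn> choose m) \<partial>\<^bsup>\<nn> - m\<^esup> \<D>\<^bsub>a - m\<^esub>\<close>; iterating produces the coefficients of the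
  grafting sum.
\<close>

section \<open>Smooth functions of finitely many variables\<close>

text \<open>Schwarz's theorem. By the mean value theorem in each variable, the second difference
  over a square of side \<open>h\<close> is \<open>h * h\<close> times either mixed derivative at
  some point of the square; continuity finishes as the squares shrink to the corner
  \<open>(a, b)\<close>.\<close>

lemma mixed_derivatives_eq:
  fixes f fx fy fxy fyx :: "real \<Rightarrow> real \<Rightarrow> real"
  assumes fx: "\<And>x y. ((\<lambda>x. f x y) has_real_derivative fx x y) (at x)"
    and fy: "\<And>x y. ((\<lambda>y. f x y) has_real_derivative fy x y) (at y)"
    and fxy: "\<And>x y. ((\<lambda>y. fx x y) has_real_derivative fxy x y) (at y)"
    and fyx: "\<And>x y. ((\<lambda>x. fy x y) has_real_derivative fyx x y) (at x)"
    and cxy: "continuous_on UNIV (\<lambda>p. fxy (fst p) (snd p))"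
    and cyx: "continuous_on UNIV (\<lambda>p. fyx (fst p) (snd p))"
  shows "fxy a b = fyx a b"
proof -
  have ex: "\<exists>p q. fxy (fst p) (snd p) = fyx (fst q) (snd q) \<and>
      p \<in> {a..a+h} \<times> {b..b+h} \<and> q \<in> {a..a+h} \<times> {b..b+h}" if h: "h > 0" for h
  proof -
    have d1: "((\<lambda>x. f x (b+h) - f x b) has_real_derivative fx x (b+h) - fx x b) (at x)" for x
      by (intro derivative_intros fx)
    obtain x1 where x1: "a < x1" "x1 < a + h"
      "(f (a+h) (b+h) - f (a+h) b) - (f a (b+h) - f a b) = (a + h - a) * (fx x1 (b+h) - fx x1 b)"
      using MVT2[of a "a+h" "\<lambda>x. f x (b+h) - f x b" "\<lambda>x. fx x (b+h) - fx x b"] d1 h by auto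
    obtain y1 where y1: "b < y1" "y1 < b + h" "fx x1 (b+h) - fx x1 b = (b + h - b) * fxy x1 y1"
      using MVT2[of b "b+h" "\<lambda>y. fx x1 y" "\<lambda>y. fxy x1 y"] fxy h by auto
    have d2: "((\<lambda>y. f (a+h) y - f a y) has_real_derivative fy (a+h) y - fy a y) (at y)" for y
      by (intro derivative_intros fy)
    obtain y2 where y2: "b < y2" "y2 < b + h"
      "(f (a+h) (b+h) - f a (b+h)) - (f (a+h) b - f a b) = (b + h - b) * (fy (a+h) y2 - fy a y2)"
      using MVT2[of b "b+h" "\<lambda>y. f (a+h) y - f a y" "\<lambda>y. fy (a+h) y - fy a y"] d2 h by auto
    obtain x2 where x2: "a < x2" "x2 < a + h" "fy (a+h) y2 - fy a y2 = (a + h - a) * fyx x2 y2"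
      using MVT2[of a "a+h" "\<lambda>x. fy x y2" "\<lambda>x. fyx x y2"] fyx h by auto
    have "h * (h * fxy x1 y1) = h * (h * fyx x2 y2)"
      using x1(3) y1(3) y2(3) x2(3) by (simp add: algebra_simps)
    then have "fxy x1 y1 = fyx x2 y2" using h by simp
    then show ?thesis
      by (intro exI[of _ "(x1, y1)"] exI[of _ "(x2, y2)"]) (use x1 x2 y1 y2 in auto)
  qed
  define h where "h n = 1 / real (Suc n)" for n
  have "\<forall>n. \<exists>p q. fxy (fst p) (snd p) = fyx (fst q) (snd q) \<and>
      p \<in> {a..a+h n} \<times> {b..b+h n} \<and> q \<in> {a..a+h n} \<times> {b..b+h n}"
    by (intro allI ex) (simp add: h_def)
  then obtain p q where pq: "\<And>n. fxy (fst (p n)) (snd (p n)) = fyx (fst (q n)) (snd (q n))"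
    "\<And>n. p n \<in> {a..a+h n} \<times> {b..b+h n}" "\<And>n. q n \<in> {a..a+h n} \<times> {b..b+h n}"
    by metis
  have h0: "h \<longlonglongrightarrow> 0" unfolding h_def by (rule LIMSEQ_Suc) (rule lim_1_over_n)
  have lim: "r \<longlonglongrightarrow> (a, b)" if r: "\<And>n. r n \<in> {a..a+h n} \<times> {b..b+h n}" for r
  proof -
    have "(\<lambda>n. (fst (r n), snd (r n))) \<longlonglongrightarrow> (a, b)"
    proof (rule tendsto_Pair)
      have ub: "(\<lambda>n. x + h n) \<longlonglongrightarrow> x" for x
        using tendsto_add[OF tendsto_const h0, of x] by simp
      have in_r: "a \<le> fst (r n) \<and> fst (r n) \<le> a + h n \<and> b \<le> snd (r n) \<and> snd (r n) \<le> b + h n" for n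
        using r[of n] by (auto simp: mem_Times_iff)
      show "(\<lambda>n. fst (r n)) \<longlonglongrightarrow> a"
        by (rule tendsto_sandwich[OF _ _ tendsto_const ub]) (use in_r in auto)
      show "(\<lambda>n. snd (r n)) \<longlonglongrightarrow> b"
        by (rule tendsto_sandwich[OF _ _ tendsto_const ub]) (use in_r in auto)
    qed
    then show ?thesis by simp
  qed
  have "(\<lambda>n. fxy (fst (p n)) (snd (p n))) \<longlonglongrightarrow> fxy (fst (a, b)) (snd (a, b))"
    by (rule continuous_on_tendsto_compose[OF cxy lim[OF pq(2)]]) auto
  moreover have "(\<lambda>n. fyx (fst (q n)) (snd (q n))) \<longlonglongrightarrow> fyx (fst (a, b)) (snd (a, b))"
    by (rule continuous_on_tendsto_compose[OF cyx lim[OF pq(3)]]) auto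
  ultimately show ?thesis using pq(1) by (simp add: LIMSEQ_unique)
qed

section \<open>Coordinate lines, \<open>Ck\<close> functions and finite dependence\<close>

definition set_var :: "('k, 'd) point \<Rightarrow> ('k, 'd) edge \<Rightarrow> nat \<Rightarrow> real \<Rightarrow> ('k, 'd) point"
  where "set_var Z a c x = Z(a := (Z a)(c := x))"

lemma set_var_apply: "set_var Z a c x b e = (if b = a \<and> e = c then x else Z b e)"
  by (simp add: set_var_def)

lemma set_var_same [simp]: "set_var Z a c (Z a c) = Z"
  by (simp add: set_var_def)

lemma set_var_overwrite [simp]: "set_var (set_var Z a c x) a c y = set_var Z a c y"
  by (simp add: set_var_def)

lemma partial_eq: "partial a c G Z = deriv (\<lambda>x. G (set_var Z a c x)) (Z a c)"
  by (simp add: partial_def set_var_def)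

definition depends_on :: "(('k, 'd) edge \<times> nat) set \<Rightarrow> (('k, 'd) point \<Rightarrow> real) \<Rightarrow> bool"
  where "depends_on S G \<longleftrightarrow> (\<forall>Z Z'. (\<forall>(a, c)\<in>S. Z a c = Z' a c) \<longrightarrow> G Z = G Z')"

text \<open>Components are not confined to the range given by \<open>dm\<close>, so the class
  carries no parameter and contains every coordinate function.\<close>

definition sfuns :: "(('k, 'd::finite) point \<Rightarrow> real) set"
  where "sfuns = {G. smooth G \<and> (\<exists>S. finite S \<and> depends_on S G)}"

lemma Ck_continuous: "Ck n G \<Longrightarrow> continuous_on UNIV G"
  by (cases n) auto

lemma Ck_partial: "Ck (Suc n) G \<Longrightarrow> Ck n (partial a c G)"
  by (simp del: split_paired_All)

lemma Ck_differentiable: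
  "Ck (Suc n) G \<Longrightarrow> (\<lambda>x. G (set_var Z a c x)) field_differentiable at (Z a c)"
  by (simp add: set_var_def del: split_paired_All)

lemma has_partial:
  assumes "Ck (Suc n) G"
  shows "((\<lambda>x. G (set_var Z a c x)) has_real_derivative partial a c G Z) (at (Z a c))"
  using Ck_differentiable[OF assms] unfolding partial_eq
  using field_differentiable_derivI by blast

lemma has_partial_at:
  assumes "Ck (Suc n) G"
  shows "((\<lambda>x. G (set_var Z a c x)) has_real_derivative partial a c G (set_var Z a c x)) (at x)"
  using has_partial[OF assms, of "set_var Z a c x" a c] by (simp add: set_var_apply)

lemma Ck_Suc_imp: "Ck (Suc n) G \<Longrightarrow> Ck n G"
  by (induction n arbitrary: G) auto

lemma partialI:
  "((\<lambda>x. G (set_var Z a c x)) has_real_derivative D) (at (Z a c)) \<Longrightarrow> partial a c G Z = D"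
  unfolding partial_eq by (rule DERIV_imp_deriv)

text \<open>One-variable derivatives are unique, so any family \<open>D\<close> of them is
  \<open>partial\<close>. This reduces the closure properties of \<open>Ck\<close> to inductions on
  the order.\<close>

lemma Ck_SucI:
  assumes "continuous_on UNIV G"
    and "\<And>a c Z. ((\<lambda>x. G (set_var Z a c x)) has_real_derivative D a c Z) (at (Z a c))"
    and "\<And>a c. Ck n (D a c)"
  shows "Ck (Suc n) G"
proof -
  have eq: "partial a c G = D a c" for a c
    by (intro ext partialI assms(2))
  have "(\<lambda>x. G (Z(a := (Z a)(c := x)))) field_differentiable at (Z a c)" for Z a c
    using assms(2)[of Z a c] unfolding set_var_def field_differentiable_def by (rule exI)
  then show ?thesis
    unfolding Ck.simps eq by (intro conjI allI assms)
qed

lemma Ck_const: "Ck n (\<lambda>Z. r)"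
proof (induction n arbitrary: r)
  case (Suc n)
  show ?case by (rule Ck_SucI[where D = "\<lambda>a c Z. 0"]) (auto intro: Suc.IH)
qed simp

lemma continuous_on_var: "continuous_on UNIV (\<lambda>Z :: ('k, 'd) point. Z b e)"
  by (rule continuous_on_product_then_coordinatewise[OF continuous_on_product_coordinates])

lemma Ck_var: "Ck n (\<lambda>Z. Z b e)"
proof (cases n)
  case 0
  then show ?thesis by (simp add: continuous_on_var)
next
  case (Suc m)
  show ?thesis unfolding Suc
  proof (rule Ck_SucI[where D = "\<lambda>a c Z. if a = b \<and> c = e then 1 else 0"])
    show "((\<lambda>x. (set_var Z a c x) b e) has_real_derivative (if a = b \<and> c = e then 1 else 0)) (at (Z a c))"
      for a c and Z :: "('a, 'b) point"
      by (cases "a = b \<and> c = e") (auto simp: set_var_apply)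
    show "Ck m (\<lambda>Z. if a = b \<and> c = e then 1 else 0)" for a c
      by (rule Ck_const)
  qed (rule continuous_on_var)
qed

lemma Ck_add: "Ck n G \<Longrightarrow> Ck n H \<Longrightarrow> Ck n (\<lambda>Z. G Z + H Z)"
proof (induction n arbitrary: G H)
  case 0
  then show ?case by (simp add: continuous_on_add)
next
  case (Suc n)
  show ?case
    by (rule Ck_SucI[where D = "\<lambda>a c Z. partial a c G Z + partial a c H Z"])
      (intro continuous_on_add Suc.IH Ck_partial DERIV_add
         has_partial[OF Suc.prems(1)] has_partial[OF Suc.prems(2)] Suc.prems
         Ck_continuous[OF Suc.prems(1)] Ck_continuous[OF Suc.prems(2)])+
qed

lemma Ck_mult: "Ck n G \<Longrightarrow> Ck n H \<Longrightarrow> Ck n (\<lambda>Z. G Z * H Z)"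
proof (induction n arbitrary: G H)
  case 0
  then show ?case by (simp add: continuous_on_mult)
next
  case (Suc n)
  show ?case
  proof (rule Ck_SucI[where D = "\<lambda>a c Z. G Z * partial a c H Z + partial a c G Z * H Z"])
    show "((\<lambda>x. G (set_var Z a c x) * H (set_var Z a c x)) has_real_derivative
        G Z * partial a c H Z + partial a c G Z * H Z) (at (Z a c))" for a c Z
      using DERIV_mult[OF has_partial[OF Suc.prems(1), of Z a c] has_partial[OF Suc.prems(2), of Z a c]]
      by (simp add: algebra_simps)
    show "continuous_on UNIV (\<lambda>Z. G Z * H Z)"
      by (intro continuous_on_mult Ck_continuous[OF Suc.prems(1)] Ck_continuous[OF Suc.prems(2)])
    show "Ck n (\<lambda>Z. G Z * partial a c H Z + partial a c G Z * H Z)" for a c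
      by (intro Ck_add Suc.IH Ck_partial Suc.prems Ck_Suc_imp[OF Suc.prems(1)] Ck_Suc_imp[OF Suc.prems(2)])
  qed
qed

lemma smoothD: "smooth G \<Longrightarrow> Ck n G"
  by (simp add: smooth_def)

lemma smooth_partial: "smooth G \<Longrightarrow> smooth (partial a c G)"
  unfolding smooth_def by (intro allI Ck_partial) (erule spec)

lemma depends_on_mono: "depends_on S G \<Longrightarrow> S \<subseteq> S' \<Longrightarrow> depends_on S' G"
  unfolding depends_on_def by (meson subsetD)

lemma depends_on_eqD:
  "depends_on S G \<Longrightarrow> (\<And>a c. (a, c) \<in> S \<Longrightarrow> Z a c = Z' a c) \<Longrightarrow> G Z = G Z'"
  unfolding depends_on_def by blast

text \<open>The inserted variable is the point \<open>Z a c\<close> at which the one-variable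
  derivative is taken.\<close>

lemma depends_on_partial:
  assumes "depends_on S G"
  shows "depends_on (insert (a, c) S) (partial a c G)"
  unfolding depends_on_def
proof (intro allI impI)
  fix Z Z' :: "('a, 'b) point"
  assume *: "\<forall>(b, e)\<in>insert (a, c) S. Z b e = Z' b e"
  have "(\<lambda>x. G (set_var Z a c x)) = (\<lambda>x. G (set_var Z' a c x))"
    by (intro ext depends_on_eqD[OF assms]) (use * in \<open>auto simp: set_var_apply\<close>)
  then show "partial a c G Z = partial a c G Z'"
    using * by (simp add: partial_eq)
qed

lemma partial_eq_0:
  assumes "depends_on S G" "(a, c) \<notin> S"
  shows "partial a c G = (\<lambda>Z. 0)"
proof
  fix Z :: "('a, 'b) point"
  have "(\<lambda>x. G (set_var Z a c x)) = (\<lambda>x. G Z)"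
    by (intro ext depends_on_eqD[OF assms(1)]) (use assms(2) in \<open>auto simp: set_var_apply\<close>)
  then show "partial a c G Z = 0"
    by (simp add: partial_eq)
qed

lemma sfuns_const: "(\<lambda>Z. r) \<in> sfuns"
  unfolding sfuns_def smooth_def depends_on_def using Ck_const by auto

lemma sfuns_var: "(\<lambda>Z. Z b e) \<in> sfuns"
  unfolding sfuns_def smooth_def depends_on_def
  by (intro CollectI conjI allI Ck_var exI[of _ "{(b, e)}"]) auto

lemma sfuns_add: "G \<in> sfuns \<Longrightarrow> H \<in> sfuns \<Longrightarrow> (\<lambda>Z. G Z + H Z) \<in> sfuns"
  and sfuns_mult: "G \<in> sfuns \<Longrightarrow> H \<in> sfuns \<Longrightarrow> (\<lambda>Z. G Z * H Z) \<in> sfuns"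
proof -
  assume "G \<in> sfuns" "H \<in> sfuns"
  then obtain S S' where S: "smooth G" "smooth H" "finite S" "depends_on S G" "finite S'" "depends_on S' H"
    unfolding sfuns_def by auto
  have *: "depends_on (S \<union> S') G" "depends_on (S \<union> S') H" "finite (S \<union> S')"
    using S by (auto intro: depends_on_mono)
  have "G Z = G Z' \<and> H Z = H Z'" if "\<forall>(a, c)\<in>S \<union> S'. Z a c = Z' a c" for Z Z'
    using *(1,2) that unfolding depends_on_def by blast
  then have "depends_on (S \<union> S') (\<lambda>Z. G Z + H Z)" "depends_on (S \<union> S') (\<lambda>Z. G Z * H Z)"
    by (simp_all add: depends_on_def)
  moreover have "smooth (\<lambda>Z. G Z + H Z)" "smooth (\<lambda>Z. G Z * H Z)"
    using S(1,2) by (auto simp: smooth_def intro: Ck_add Ck_mult)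
  ultimately show "(\<lambda>Z. G Z + H Z) \<in> sfuns" "(\<lambda>Z. G Z * H Z) \<in> sfuns"
    using *(3) unfolding sfuns_def by auto
qed

lemma sfuns_uminus: "G \<in> sfuns \<Longrightarrow> (\<lambda>Z. - G Z) \<in> sfuns"
  using sfuns_mult[OF sfuns_const[of "-1"], of G] by simp

lemma sfuns_diff: "G \<in> sfuns \<Longrightarrow> H \<in> sfuns \<Longrightarrow> (\<lambda>Z. G Z - H Z) \<in> sfuns"
  using sfuns_add[OF _ sfuns_uminus, of G H] by simp

lemma sfuns_partial: "G \<in> sfuns \<Longrightarrow> partial a c G \<in> sfuns"
proof -
  assume "G \<in> sfuns"
  then obtain S where S: "smooth G" "finite S" "depends_on S G"
    unfolding sfuns_def by auto
  then show ?thesis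
    using depends_on_partial[OF S(3), of a c] smooth_partial[OF S(1)] finite_insert[of "(a, c)" S]
    unfolding sfuns_def by blast
qed

text \<open>Points carry the product topology, and each coordinate of this map is a projection or
  constant. Continuity on the whole space thus restricts to coordinate planes, as Schwarz's theorem
  requires.\<close>

lemma continuous_on_set_var:
  fixes Z :: "('k, 'd) point"
  shows "continuous_on UNIV (\<lambda>p. set_var (set_var Z a c (fst p)) b e (snd p))"
proof (rule continuous_on_coordinatewise_then_product, rule continuous_on_coordinatewise_then_product)
  fix a' c'
  consider "a' = b \<and> c' = e" | "\<not> (a' = b \<and> c' = e)" "a' = a \<and> c' = c"
    | "\<not> (a' = b \<and> c' = e)" "\<not> (a' = a \<and> c' = c)" by blast
  then show "continuous_on UNIV (\<lambda>p. (set_var (set_var Z a c (fst p)) b e (snd p)) a' c')"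
  proof cases
    case 1
    then have "(\<lambda>p. (set_var (set_var Z a c (fst p)) b e (snd p)) a' c') = snd"
      by (auto simp: fun_eq_iff set_var_apply)
    then show ?thesis by (simp only: continuous_on_snd continuous_on_id)
  next
    case 2
    then have "(\<lambda>p. (set_var (set_var Z a c (fst p)) b e (snd p)) a' c') = fst"
      by (auto simp: fun_eq_iff set_var_apply)
    then show ?thesis by (simp only: continuous_on_fst continuous_on_id)
  next
    case 3
    then have "(\<lambda>p. (set_var (set_var Z a c (fst p)) b e (snd p)) a' c') = (\<lambda>p. Z a' c')"
      by (auto simp: fun_eq_iff set_var_apply)
    then show ?thesis by (simp only: continuous_on_const)
  qed
qed

text \<open>Schwarz's theorem on the plane through \<open>Z\<close> spanned by the two coordinates;
  equal coordinates span no plane but leave nothing to show.\<close>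

lemma partial_commute:
  assumes "smooth G"
  shows "partial a c (partial b e G) = partial b e (partial a c G)"
proof (cases "(a, c) = (b, e)")
  case False
  show ?thesis
  proof
    fix Z :: "('a, 'b) point"
    define W where "W x y = set_var (set_var Z a c x) b e y" for x y
    have Wx: "W x y = set_var (W x' y) a c x" and Wy: "W x y = set_var (W x y') b e y" for x y x' y'
      using False by (auto simp: W_def fun_eq_iff set_var_apply)
    have W0: "W (Z a c) (Z b e) = Z" by (simp add: W_def)
    have cont: "continuous_on UNIV (\<lambda>p. H (W (fst p) (snd p)))" if "Ck n H" for n H
      using continuous_on_compose2[OF Ck_continuous[OF that] continuous_on_set_var]
      by (auto simp: W_def)
    have C: "Ck (Suc n) G" "Ck (Suc n) (partial a c G)" "Ck n (partial b e (partial a c G))"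
       "Ck n (partial a c (partial b e G))" for n a c b e
      by (intro smoothD smooth_partial assms)+
    have dx: "((\<lambda>x. H (W x y)) has_real_derivative partial a c H (W x y)) (at x)"
      if "Ck (Suc 0) H" for H x y
      using has_partial_at[OF that, of "W x y" a c x] unfolding Wx[of _ y x, symmetric] .
    have dy: "((\<lambda>y. H (W x y)) has_real_derivative partial b e H (W x y)) (at y)"
      if "Ck (Suc 0) H" for H x y
      using has_partial_at[OF that, of "W x y" b e y] unfolding Wy[of x _ y, symmetric] .
    have "partial b e (partial a c G) (W (Z a c) (Z b e)) = partial a c (partial b e G) (W (Z a c) (Z b e))"
      by (rule mixed_derivatives_eq[OF dx dy dy dx cont cont]) (rule C)+
    then show "partial a c (partial b e G) Z = partial b e (partial a c G) Z"
      by (simp add: W0)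
  qed
qed simp

text \<open>With smoothness and finite dependence built into a type, the functions form a
  commutative real algebra, and derivations and linear maps on it carry no side conditions.\<close>

typedef ('k, 'd) sfun = "sfuns :: (('k, 'd::finite) point \<Rightarrow> real) set"
  using sfuns_const by auto

setup_lifting type_definition_sfun

instantiation sfun :: (type, finite) comm_ring_1
begin
lift_definition zero_sfun :: "('a, 'b) sfun" is "\<lambda>Z. 0" by (rule sfuns_const)
lift_definition one_sfun :: "('a, 'b) sfun" is "\<lambda>Z. 1" by (rule sfuns_const)
lift_definition plus_sfun :: "('a, 'b) sfun \<Rightarrow> ('a, 'b) sfun \<Rightarrow> ('a, 'b) sfun"
  is "\<lambda>G H Z. G Z + H Z" by (rule sfuns_add)
lift_definition minus_sfun :: "('a, 'b) sfun \<Rightarrow> ('a, 'b) sfun \<Rightarrow> ('a, 'b) sfun"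
  is "\<lambda>G H Z. G Z - H Z" by (rule sfuns_diff)
lift_definition uminus_sfun :: "('a, 'b) sfun \<Rightarrow> ('a, 'b) sfun"
  is "\<lambda>G Z. - G Z" by (rule sfuns_uminus)
lift_definition times_sfun :: "('a, 'b) sfun \<Rightarrow> ('a, 'b) sfun \<Rightarrow> ('a, 'b) sfun"
  is "\<lambda>G H Z. G Z * H Z" by (rule sfuns_mult)
instance
proof
  fix x y z :: "('a, 'b) sfun"
  show "x * y * z = x * (y * z)" by transfer (simp add: mult.assoc)
  show "x * y = y * x" by transfer (simp add: mult.commute)
  show "1 * x = x" by transfer simp
  show "(x + y) * z = x * z + y * z" by transfer (simp add: distrib_right)
  show "x + y + z = x + (y + z)" by transfer (simp add: add.assoc)
  show "x + y = y + x" by transfer (simp add: add.commute)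
  show "0 + x = x" by transfer simp
  show "- x + x = 0" by transfer simp
  show "x - y = x + - y" by transfer simp
  show "(0 :: ('a, 'b) sfun) \<noteq> 1" by transfer (metis zero_neq_one)
qed
end

instantiation sfun :: (type, finite) real_algebra_1
begin
lift_definition scaleR_sfun :: "real \<Rightarrow> ('a, 'b) sfun \<Rightarrow> ('a, 'b) sfun"
  is "\<lambda>r G Z. r * G Z" using sfuns_mult[OF sfuns_const] by auto
instance
proof
  fix x y :: "('a, 'b) sfun" and q r :: real
  show "q *\<^sub>R (x + y) = q *\<^sub>R x + q *\<^sub>R y" by transfer (simp add: distrib_left)
  show "(q + r) *\<^sub>R x = q *\<^sub>R x + r *\<^sub>R x" by transfer (simp add: distrib_right)
  show "q *\<^sub>R r *\<^sub>R x = (q * r) *\<^sub>R x" by transfer (simp add: mult.assoc)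
  show "1 *\<^sub>R x = x" by transfer simp
  show "q *\<^sub>R x * y = q *\<^sub>R (x * y)" by transfer (simp add: mult.assoc)
  show "x * q *\<^sub>R y = q *\<^sub>R (x * y)" by transfer (simp add: mult.left_commute)
qed
end

lift_definition var :: "('k, 'd::finite) edge \<Rightarrow> nat \<Rightarrow> ('k, 'd) sfun"
  is "\<lambda>a c Z. Z a c" by (rule sfuns_var)

lift_definition vderiv :: "('k, 'd::finite) edge \<Rightarrow> nat \<Rightarrow> ('k, 'd) sfun \<Rightarrow> ('k, 'd) sfun"
  is partial by (rule sfuns_partial)

lemma Rep_sfun_sum: "Rep_sfun (sum f I) Z = (\<Sum>i\<in>I. Rep_sfun (f i) Z)"
  by (induction I rule: infinite_finite_induct) (auto simp: zero_sfun.rep_eq plus_sfun.rep_eq)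

lemma Rep_sfun_scaleR: "Rep_sfun (r *\<^sub>R G) Z = r * Rep_sfun G Z"
  by (simp add: scaleR_sfun.rep_eq)

lemma sfunsD: "G \<in> sfuns \<Longrightarrow> Ck n G"
  by (simp add: sfuns_def smooth_def)

section \<open>Derivations of the algebra \<open>sfun\<close>\<close>

definition derivation :: "(('k, 'd::finite) sfun \<Rightarrow> ('k, 'd) sfun) \<Rightarrow> bool"
  where "derivation A \<longleftrightarrow> linear A \<and> (\<forall>x y. A (x * y) = x * A y + A x * y)"

lemma derivation_linear: "derivation A \<Longrightarrow> linear A"
  and derivation_mult: "derivation A \<Longrightarrow> A (x * y) = x * A y + A x * y"
  by (simp_all add: derivation_def)

lemma derivation_sum: "(\<And>j. j \<in> J \<Longrightarrow> derivation (A j)) \<Longrightarrow> derivation (\<lambda>G. \<Sum>j\<in>J. A j G)"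
  unfolding derivation_def
  by (simp add: linear_compose_sum sum.distrib sum_distrib_left sum_distrib_right)

lemma derivation_scaleR: "derivation A \<Longrightarrow> derivation (\<lambda>G. r *\<^sub>R A G)"
  unfolding derivation_def by (simp add: linear_compose_scale_right scaleR_add_right)

lemma derivation_vderiv: "derivation (vderiv a c)"
  unfolding derivation_def
proof (intro conjI allI linearI)
  fix x y :: "('a, 'b) sfun" and r :: real
  show "vderiv a c (x + y) = vderiv a c x + vderiv a c y"
    by transfer (intro ext partialI DERIV_add has_partial[of 0] sfunsD; assumption)
  show "vderiv a c (r *\<^sub>R x) = r *\<^sub>R vderiv a c x"
    by transfer (intro ext partialI DERIV_cmult has_partial[of 0] sfunsD; assumption)
  show "vderiv a c (x * y) = x * vderiv a c y + vderiv a c x * y"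
  proof transfer
    fix a :: "('a, 'b) edge" and c :: nat and x y :: "('a, 'b) point \<Rightarrow> real"
    assume "x \<in> sfuns" "y \<in> sfuns"
    then have "((\<lambda>t. x (set_var Z a c t) * y (set_var Z a c t)) has_real_derivative
        (x Z * partial a c y Z + partial a c x Z * y Z)) (at (Z a c))" for Z
      using DERIV_mult[OF has_partial[of 0 x Z a c] has_partial[of 0 y Z a c]]
      by (simp only: sfunsD set_var_same mult.commute add.commute)
    then show "partial a c (\<lambda>Z. x Z * y Z) = (\<lambda>Z. x Z * partial a c y Z + partial a c x Z * y Z)"
      by (intro ext partialI)
  qed
qed

lemma linear_vderiv: "linear (vderiv a c)"
  using derivation_vderiv derivation_linear by blast

lemma vderiv_commute: "vderiv a c (vderiv b e G) = vderiv b e (vderiv a c G)"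
  by transfer (rule partial_commute, simp add: sfuns_def)

lemma vderiv_var: "vderiv a c (var b e) = (if a = b \<and> c = e then 1 else 0)"
proof (transfer, goal_cases)
  case (1 a c b e)
  have "((\<lambda>x. (set_var Z a c x) b e) has_real_derivative (if a = b \<and> c = e then 1 else 0)) (at (Z a c))"
    for Z :: "('a, 'b) point"
    by (cases "a = b \<and> c = e") (auto simp: set_var_apply)
  then have "partial a c (\<lambda>Z. Z b e) Z = (if a = b \<and> c = e then 1 else 0)" for Z :: "('a, 'b) point"
    by (rule partialI)
  then show ?case by (simp add: fun_eq_iff)
qed

text \<open>There are infinitely many edge decorations; this is what makes the sum in
  \<open>total_deriv\<close> finite.\<close>

lemma finite_edges_vderiv: "finite {a. \<exists>c. vderiv a c G \<noteq> 0}"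
proof -
  obtain S where S: "finite S" "depends_on S (Rep_sfun G)"
    using Rep_sfun[of G] unfolding sfuns_def by auto
  have "vderiv a c G = 0" if "a \<notin> fst ` S" for a c
  proof -
    have "(a, c) \<notin> S" using that by force
    from partial_eq_0[OF S(2) this] show ?thesis
      by (simp add: Rep_sfun_inject[symmetric] vderiv.rep_eq zero_sfun.rep_eq)
  qed
  then have "{a. \<exists>c. vderiv a c G \<noteq> 0} \<subseteq> fst ` S" by blast
  then show ?thesis using S(1) finite_subset by blast
qed

declare One_nat_def [simp del]

lemma derivation_mult_left: "derivation A \<Longrightarrow> derivation (\<lambda>G. f * A G)"
  unfolding derivation_def
  by (auto simp: linear_iff algebra_simps)

lemma vderiv_eq_0_vderiv: "vderiv b e G = 0 \<Longrightarrow> vderiv b e (vderiv a c G) = 0"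
  by (simp add: vderiv_commute[of b e] linear_0[OF linear_vderiv])

lemma edges_vderiv_subset: "{a. \<exists>c. vderiv a c (vderiv b e G) \<noteq> 0} \<subseteq> {a. \<exists>c. vderiv a c G \<noteq> 0}"
  using vderiv_eq_0_vderiv by blast

section \<open>Total derivatives and their commutators\<close>

definition tderiv :: "('k \<Rightarrow> nat) \<Rightarrow> 'd::finite \<Rightarrow> ('k, 'd) sfun \<Rightarrow> ('k, 'd) sfun"
  where "tderiv dm r G =
    (\<Sum>a | \<exists>c. vderiv a c G \<noteq> 0. \<Sum>c<dm (fst a). var (fst a, snd a + axis r 1) c * vderiv a c G)"

lemma tderiv_superset:
  assumes "finite S" "{a. \<exists>c. vderiv a c G \<noteq> 0} \<subseteq> S"
  shows "tderiv dm r G = (\<Sum>a\<in>S. \<Sum>c<dm (fst a). var (fst a, snd a + axis r 1) c * vderiv a c G)"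
  unfolding tderiv_def by (rule sum.mono_neutral_left[OF assms]) auto

lemma Rep_tderiv: "Rep_sfun (tderiv dm r G) = total_deriv dm r (Rep_sfun G)"
proof
  fix Z
  let ?S = "{a. \<exists>c. vderiv a c G \<noteq> 0}"
  let ?f = "\<lambda>a. \<Sum>c<dm (fst a). Z (fst a, snd a + axis r 1) c * partial a c (Rep_sfun G) Z"
  have 0: "?f a = 0" if "a \<notin> ?S" for a
  proof -
    have "partial a c (Rep_sfun G) Z = 0" for c
      using that by (simp add: vderiv.rep_eq[symmetric] zero_sfun.rep_eq)
    then show ?thesis by simp
  qed
  have "total_deriv dm r (Rep_sfun G) Z = (\<Sum>a\<in>?S. ?f a)"
    unfolding total_deriv_def
    by (rule Sum_any.expand_superset[OF finite_edges_vderiv]) (use 0 in blast)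
  then show "Rep_sfun (tderiv dm r G) Z = total_deriv dm r (Rep_sfun G) Z"
    by (simp add: tderiv_def Rep_sfun_sum times_sfun.rep_eq vderiv.rep_eq var.rep_eq)
qed

text \<open>The range of summation in \<open>tderiv\<close> varies with the argument. On finitely
  many functions a common range turns it into a fixed combination of partial derivatives, which is a
  derivation, and each law involves only a few functions.\<close>

lemma derivation_tderiv: "derivation (tderiv dm r)"
proof -
  have ex: "\<exists>A. derivation A \<and> (\<forall>G\<in>N. tderiv dm r G = A G)" if "finite N" for N :: "('a, 'b) sfun set"
  proof (intro exI conjI ballI)
    let ?S = "\<Union>G\<in>N. {a. \<exists>c. vderiv a c G \<noteq> 0}"
    let ?A = "\<lambda>G. \<Sum>a\<in>?S. \<Sum>c<dm (fst a). var (fst a, snd a + axis r 1) c * vderiv a c G"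
    show "derivation ?A"
      by (rule derivation_sum, rule derivation_sum, rule derivation_mult_left, rule derivation_vderiv)
    show "tderiv dm r G = ?A G" if "G \<in> N" for G
      by (rule tderiv_superset) (use that \<open>finite N\<close> finite_edges_vderiv in \<open>blast+\<close>)
  qed
  show ?thesis
    unfolding derivation_def
  proof (intro conjI allI linearI)
    fix x y :: "('a, 'b) sfun" and q :: real
    obtain A where A: "derivation A"
      "\<And>G. G \<in> {x, y, x + y, x * y, q *\<^sub>R x} \<Longrightarrow> tderiv dm r G = A G"
      using ex[of "{x, y, x + y, x * y, q *\<^sub>R x}"] by auto
    show "tderiv dm r (x + y) = tderiv dm r x + tderiv dm r y"
      using A linear_add[OF derivation_linear] by simp
    show "tderiv dm r (q *\<^sub>R x) = q *\<^sub>R tderiv dm r x"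
      using A linear_scale[OF derivation_linear] by simp
    show "tderiv dm r (x * y) = x * tderiv dm r y + tderiv dm r x * y"
      using A derivation_mult by simp
  qed
qed

lemma linear_tderiv: "linear (tderiv dm r)"
  using derivation_tderiv derivation_linear by blast

lemma tderiv_var: "tderiv dm r (var b e) = (if e < dm (fst b) then var (fst b, snd b + axis r 1) e else 0)"
proof -
  have "tderiv dm r (var b e) =
      (\<Sum>a\<in>{b}. \<Sum>c<dm (fst a). var (fst a, snd a + axis r 1) c * vderiv a c (var b e))"
    by (rule tderiv_superset) (auto simp: vderiv_var)
  also have "\<dots> = (\<Sum>c<dm (fst b). if c = e then var (fst b, snd b + axis r 1) c else 0)"
    by (simp add: vderiv_var if_distrib cong: if_cong)
  finally show ?thesis by simp
qed

text \<open>Expanding gives a second-order part and a first-order part. The former is symmetric in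
  \<open>r\<close> and \<open>s\<close> after exchanging the two summations, by
  \<open>vderiv_commute\<close>; the latter because its coefficients are the variables at
  \<open>snd b + axis s 1 + axis r 1\<close>.\<close>

lemma tderiv_commute: "tderiv dm r (tderiv dm s G) = tderiv dm s (tderiv dm r G)"
proof -
  define S where "S = {a. \<exists>c. vderiv a c G \<noteq> 0}"
  \<comment> \<open>\<open>S\<close> also serves for the derivatives of \<open>G\<close>, since
    differentiation brings in no new variables.\<close>
  have td: "tderiv dm r (vderiv b e G) = (\<Sum>a\<in>S. \<Sum>c<dm (fst a). var (fst a, snd a + axis r 1) c * vderiv a c (vderiv b e G))"
    for r b e
    unfolding S_def by (rule tderiv_superset[OF finite_edges_vderiv edges_vderiv_subset])
  have eq: "tderiv dm r (tderiv dm s G) =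
      (\<Sum>b\<in>S. \<Sum>e<dm (fst b). \<Sum>a\<in>S. \<Sum>c<dm (fst a).
         var (fst b, snd b + axis s 1) e * var (fst a, snd a + axis r 1) c * vderiv a c (vderiv b e G)) +
      (\<Sum>b\<in>S. \<Sum>e<dm (fst b). var (fst b, snd b + axis s 1 + axis r 1) e * vderiv b e G)" for r s
  proof -
    have "tderiv dm r (tderiv dm s G) =
      (\<Sum>b\<in>S. \<Sum>e<dm (fst b). var (fst b, snd b + axis s 1) e * tderiv dm r (vderiv b e G) +
         tderiv dm r (var (fst b, snd b + axis s 1) e) * vderiv b e G)"
      unfolding tderiv_def[of dm s] S_def[symmetric]
      by (simp add: linear_sum[OF linear_tderiv] derivation_mult[OF derivation_tderiv])
    also have "\<dots> = (\<Sum>b\<in>S. \<Sum>e<dm (fst b). (\<Sum>a\<in>S. \<Sum>c<dm (fst a).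
         var (fst b, snd b + axis s 1) e * var (fst a, snd a + axis r 1) c * vderiv a c (vderiv b e G)) +
         var (fst b, snd b + axis s 1 + axis r 1) e * vderiv b e G)"
      by (intro sum.cong refl) (simp add: td tderiv_var sum_distrib_left mult.assoc)
    finally show ?thesis by (simp add: sum.distrib)
  qed
  have "(\<Sum>b\<in>S. \<Sum>e<dm (fst b). \<Sum>a\<in>S. \<Sum>c<dm (fst a).
         var (fst b, snd b + axis s 1) e * var (fst a, snd a + axis r 1) c * vderiv a c (vderiv b e G)) =
      (\<Sum>(b, e)\<in>Sigma S (\<lambda>b. {..<dm (fst b)}). \<Sum>(a, c)\<in>Sigma S (\<lambda>b. {..<dm (fst b)}).
         var (fst b, snd b + axis s 1) e * var (fst a, snd a + axis r 1) c * vderiv a c (vderiv b e G))" for r s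
    using finite_edges_vderiv[of G] by (subst (1 2) sum.Sigma) (auto simp: S_def)
  note Sig = this
  have "(\<Sum>b\<in>S. \<Sum>e<dm (fst b). \<Sum>a\<in>S. \<Sum>c<dm (fst a).
         var (fst b, snd b + axis s 1) e * var (fst a, snd a + axis r 1) c * vderiv a c (vderiv b e G)) =
      (\<Sum>b\<in>S. \<Sum>e<dm (fst b). \<Sum>a\<in>S. \<Sum>c<dm (fst a).
         var (fst b, snd b + axis r 1) e * var (fst a, snd a + axis s 1) c * vderiv a c (vderiv b e G))"
    unfolding Sig case_prod_unfold
    by (subst sum.swap) (intro sum.cong refl arg_cong2[where f = "(*)"] vderiv_commute mult.commute)
  then show ?thesis
    unfolding eq by (simp add: add.commute add.left_commute)
qed

lemma midx_le_add_iff: "(m :: 'd::finite midx) + j \<le> p \<longleftrightarrow> m \<le> p \<and> j \<le> p - m"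
proof -
  have "m $ i + j $ i \<le> p $ i \<longleftrightarrow> m $ i \<le> p $ i \<and> j $ i \<le> p $ i - m $ i" for i
    by linarith
  then show ?thesis by (simp add: less_eq_vec_def all_conj_distrib)
qed

text \<open>Subtraction is truncated, so solving for \<open>m\<close> needs
  \<open>axis r 1 \<le> p\<close>. In \<open>vderiv_tderiv\<close> this singles out the coefficient
  of the total derivative that is a given variable.\<close>

lemma midx_eq_add_iff: "(p :: 'd::finite midx) = m + axis r 1 \<longleftrightarrow> m = p - axis r 1 \<and> axis r 1 \<le> p"
proof -
  have "p $ i = m $ i + axis r 1 $ i \<longleftrightarrow> m $ i = p $ i - axis r 1 $ i \<and> axis r 1 $ i \<le> p $ i" for i
    by linarith
  then show ?thesis by (simp add: vec_eq_iff less_eq_vec_def all_conj_distrib)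
qed

text \<open>By the Leibniz rule the partial derivative also hits the coefficients of the total
  derivative. The one that is the variable \<open>b\<close> belongs to the edge \<open>b\<close>
  lowered by \<open>axis r 1\<close>, provided this exists and \<open>e\<close> is in range.\<close>

lemma vderiv_tderiv:
  "vderiv b e (tderiv dm r G) = tderiv dm r (vderiv b e G) +
     (if axis r 1 \<le> snd b \<and> e < dm (fst b) then vderiv (fst b, snd b - axis r 1) e G else 0)"
proof -
  define b' where "b' = (fst b, snd b - axis r 1)"
  \<comment> \<open>\<open>b'\<close> is put in by hand so that the extra term is among the summands
    even if all derivatives of \<open>G\<close> along \<open>b'\<close> vanish.\<close>
  define S where "S = insert b' {a. \<exists>c. vderiv a c G \<noteq> 0}"
  have S: "finite S" by (simp add: S_def finite_edges_vderiv)
  have 1: "tderiv dm r (vderiv b e G) = (\<Sum>a\<in>S. \<Sum>c<dm (fst a). var (fst a, snd a + axis r 1) c * vderiv a c (vderiv b e G))"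
    by (rule tderiv_superset[OF S]) (use edges_vderiv_subset[of b e G] in \<open>auto simp: S_def\<close>)
  have iff: "(b = (fst a, snd a + axis r 1)) \<longleftrightarrow> (a = b' \<and> axis r 1 \<le> snd b)" for a
    by (auto simp: b'_def prod_eq_iff midx_eq_add_iff)
  have "vderiv b e (tderiv dm r G) = (\<Sum>a\<in>S. \<Sum>c<dm (fst a).
      vderiv b e (var (fst a, snd a + axis r 1) c * vderiv a c G))"
    by (subst tderiv_superset[OF S]) (auto simp: S_def linear_sum[OF linear_vderiv])
  also have "\<dots> = (\<Sum>a\<in>S. \<Sum>c<dm (fst a). var (fst a, snd a + axis r 1) c * vderiv a c (vderiv b e G) +
      (if a = b' \<and> axis r 1 \<le> snd b \<and> c = e then vderiv a c G else 0))"
    by (intro sum.cong refl) (auto simp: derivation_mult[OF derivation_vderiv] vderiv_var iff vderiv_commute[of b e])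
  also have "\<dots> = tderiv dm r (vderiv b e G) +
      (\<Sum>a\<in>S. \<Sum>c<dm (fst a). if a = b' \<and> axis r 1 \<le> snd b \<and> c = e then vderiv a c G else 0)"
    by (simp add: sum.distrib 1)
  also have "(\<Sum>a\<in>S. \<Sum>c<dm (fst a). if a = b' \<and> axis r 1 \<le> snd b \<and> c = e then vderiv a c G else 0) =
      (\<Sum>a\<in>S. if a = b' then (if axis r 1 \<le> snd b \<and> e < dm (fst a) then vderiv a e G else 0) else 0)"
    by (intro sum.cong refl) (auto simp: sum.delta)
  also have "\<dots> = (if axis r 1 \<le> snd b \<and> e < dm (fst b) then vderiv b' e G else 0)"
    using S by (simp add: sum.delta S_def b'_def)
  finally show ?thesis by (simp add: b'_def)
qed

section \<open>Derivatives in frozen directions\<close>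

definition cderiv :: "('k \<Rightarrow> nat) \<Rightarrow> ('k, 'd::finite) edge \<Rightarrow> (nat \<Rightarrow> real) \<Rightarrow> ('k, 'd) sfun \<Rightarrow> ('k, 'd) sfun"
  where "cderiv dm a u G = (\<Sum>c<dm (fst a). u c *\<^sub>R vderiv a c G)"

lemma derivation_cderiv: "derivation (cderiv dm a u)"
  unfolding cderiv_def by (rule derivation_sum, rule derivation_scaleR, rule derivation_vderiv)

lemma linear_cderiv: "linear (cderiv dm a u)"
  using derivation_cderiv derivation_linear by blast

lemma cderiv_commute: "cderiv dm a u (cderiv dm b v G) = cderiv dm b v (cderiv dm a u G)"
  unfolding cderiv_def linear_sum[OF linear_vderiv] linear_scale[OF linear_vderiv] scaleR_sum_right
  by (subst sum.swap) (simp add: vderiv_commute[of a] mult.commute)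

lemma cderiv_cong: "(\<And>c. c < dm (fst a) \<Longrightarrow> u c = v c) \<Longrightarrow> cderiv dm a u = cderiv dm a v"
  unfolding cderiv_def by (intro ext sum.cong) auto

text \<open>Implements the convention that a tree with an edge decoration outside the multi-indices
  is 0; truncated subtraction alone could leave a wrong nonzero term.\<close>

definition cderiv_shift ::
    "('k \<Rightarrow> nat) \<Rightarrow> ('k, 'd::finite) edge \<Rightarrow> (nat \<Rightarrow> real) \<Rightarrow> 'd midx \<Rightarrow> ('k, 'd) sfun \<Rightarrow> ('k, 'd) sfun"
  where "cderiv_shift dm a u m G = (if m \<le> snd a then cderiv dm (fst a, snd a - m) u G else 0)"

lemma cderiv_tderiv:
  "cderiv dm a u (tderiv dm r G) = tderiv dm r (cderiv dm a u G) + cderiv_shift dm a u (axis r 1) G"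
  unfolding cderiv_def cderiv_shift_def
  by (simp add: vderiv_tderiv linear_sum[OF linear_tderiv] linear_scale[OF linear_tderiv]
      scaleR_add_right sum.distrib)

text \<open>The commutator of a shifted derivative with a total derivative is a derivative shifted
  once more, so the relation can be iterated. If \<open>m \<le> snd a\<close> fails, it fails for
  \<open>m + axis r 1\<close> too, and both sides are 0.\<close>

lemma cderiv_shift_tderiv:
  "cderiv_shift dm a u m (tderiv dm r G) =
    tderiv dm r (cderiv_shift dm a u m G) + cderiv_shift dm a u (m + axis r 1) G"
proof (cases "m \<le> snd a")
  case True
  have "snd a - m - axis r 1 = snd a - (m + axis r 1)"
    by (simp add: vec_eq_iff)
  then show ?thesis
    using True by (simp add: cderiv_shift_def cderiv_tderiv midx_le_add_iff)
next
  case False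
  then show ?thesis
    by (simp add: cderiv_shift_def midx_le_add_iff linear_0[OF linear_tderiv])
qed

section \<open>Powers of the total derivatives\<close>

lemma midx_induct [case_names zero add]:
  fixes k :: "'d::finite midx"
  assumes "P 0" and "\<And>k r. P k \<Longrightarrow> P (k + axis r 1)"
  shows "P k"
proof (induction "\<Sum>r\<in>UNIV. k $ r" arbitrary: k rule: less_induct)
  case less
  show ?case
  proof (cases "k = 0")
    case False
    then obtain r where r: "k $ r > 0" by (auto simp: vec_eq_iff)
    define j where "j = k - axis r 1"
    have k: "k = j + axis r 1" using r by (auto simp: j_def vec_eq_iff axis_def)
    have "(\<Sum>r\<in>UNIV. j $ r) < (\<Sum>r\<in>UNIV. k $ r)"
      by (rule sum_strict_mono_ex1) (auto simp: k axis_def)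
    from less[OF this] show ?thesis unfolding k by (rule assms(2))
  qed (simp add: assms(1))
qed

lemma finite_midx_le: "finite {m :: 'd::finite midx. m \<le> k}"
proof (rule finite_subset)
  show "{m. m \<le> k} \<subseteq> vec_lambda ` (PiE UNIV (\<lambda>r. {..k $ r}))"
  proof
    fix m assume "m \<in> {m. m \<le> k}"
    then show "m \<in> vec_lambda ` (PiE UNIV (\<lambda>r. {..k $ r}))"
      by (intro image_eqI[of _ _ "vec_nth m"]) (auto simp: less_eq_vec_def)
  qed
  show "finite (vec_lambda ` (PiE UNIV (\<lambda>r. {..k $ r})))"
    by (intro finite_imageI finite_PiE) auto
qed

lemma multi_power_0 [simp]:
  fixes A :: "'d::{finite,linorder} \<Rightarrow> 'b \<Rightarrow> 'b"
  shows "multi_power A 0 = id"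
proof -
  have "foldr (\<lambda>r f. (A r ^^ ((0 :: 'd midx) $ r)) \<circ> f) xs id = id" for xs
    by (induction xs) auto
  then show ?thesis by (simp add: multi_power_def)
qed

text \<open>The new factor joins the power of \<open>A r\<close> inside the ordered composition;
  commutation carries it outward past the factors with earlier indices.\<close>

lemma multi_power_add_axis:
  assumes comm: "\<And>r s. A r \<circ> A s = A s \<circ> A r"
  shows "multi_power A (k + axis r 1) = A r \<circ> multi_power A k"
proof -
  have pow: "A s ^^ n \<circ> A r = A r \<circ> A s ^^ n" for s n
  proof (induction n)
    case (Suc n)
    have "A s ^^ Suc n \<circ> A r = A s \<circ> (A s ^^ n \<circ> A r)" by (simp add: comp_assoc)
    also have "\<dots> = (A s \<circ> A r) \<circ> A s ^^ n" unfolding Suc.IH by (simp add: comp_assoc)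
    also have "\<dots> = A r \<circ> A s ^^ Suc n" unfolding comm[of s r] by (simp add: comp_assoc)
    finally show ?case .
  qed simp
  let ?f = "\<lambda>k xs. foldr (\<lambda>r f. (A r ^^ (k $ r)) \<circ> f) xs id"
  have "?f (k + axis r 1) xs = (if r \<in> set xs then A r \<circ> ?f k xs else ?f k xs)" if "distinct xs" for xs
    using that
  proof (induction xs)
    case (Cons s xs)
    have IH: "?f (k + axis r 1) xs = (if r \<in> set xs then A r \<circ> ?f k xs else ?f k xs)"
      by (rule Cons.IH) (use Cons.prems in simp)
    have rec: "?f j (s # xs) = A s ^^ (j $ s) \<circ> ?f j xs" for j by simp
    show ?case
    proof (cases "s = r")
      case True
      have "A s ^^ ((k + axis r 1) $ s) = A r \<circ> A s ^^ (k $ s)"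
        using True by (simp add: axis_def One_nat_def)
      then show ?thesis
        unfolding rec IH using True Cons.prems by (simp add: comp_assoc)
    next
      case False
      then have "A s ^^ ((k + axis r 1) $ s) = A s ^^ (k $ s)"
        by (simp add: axis_def)
      then have "?f (k + axis r 1) (s # xs) =
          (if r \<in> set xs then (A s ^^ (k $ s) \<circ> A r) \<circ> ?f k xs else A s ^^ (k $ s) \<circ> ?f k xs)"
        unfolding rec IH by (simp add: comp_assoc)
      then show ?thesis unfolding pow rec using False by (simp add: comp_assoc)
    qed
  qed simp
  from this[of "sorted_list_of_set UNIV"] show ?thesis
    by (simp add: multi_power_def)
qed

text \<open>Both sides apply their operators in the same order, so a relation kept by every single
  step survives. It is used to pass from \<open>tderiv\<close> to \<open>total_deriv\<close>, and to
  match raising on trees with \<open>tderiv\<close> on functions.\<close>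

lemma multi_power_rel:
  assumes "\<And>r x y. R x y \<Longrightarrow> R (A r x) (B r y)" and "R x y"
  shows "R (multi_power A k x) (multi_power B k y)"
proof -
  have pow: "R ((A r ^^ n) x) ((B r ^^ n) y)" if "R x y" for r n x y
    using that by (induction n) (auto intro: assms(1))
  have "R (foldr (\<lambda>r f. (A r ^^ (k $ r)) \<circ> f) xs id x) (foldr (\<lambda>r f. (B r ^^ (k $ r)) \<circ> f) xs id y)" for xs
    by (induction xs) (auto intro: pow assms(2))
  then show ?thesis by (simp add: multi_power_def)
qed

definition tpow :: "('k \<Rightarrow> nat) \<Rightarrow> 'd::{finite,linorder} midx \<Rightarrow> ('k, 'd) sfun \<Rightarrow> ('k, 'd) sfun"
  where "tpow dm k = multi_power (tderiv dm) k"

lemma tpow_0 [simp]: "tpow dm 0 G = G"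
  by (simp add: tpow_def)

lemma tpow_add_axis: "tpow dm (k + axis r 1) G = tderiv dm r (tpow dm k G)"
  by (simp add: tpow_def multi_power_add_axis fun_eq_iff tderiv_commute)

lemma linear_tpow: "linear (tpow dm k)"
  by (induction k rule: midx_induct)
    (auto simp: linear_iff tpow_add_axis linear_add[OF linear_tderiv] linear_scale[OF linear_tderiv])

lemma Rep_tpow: "Rep_sfun (tpow dm k G) = multi_power (total_deriv dm) k (Rep_sfun G)"
  unfolding tpow_def
  by (rule multi_power_rel[where R = "\<lambda>x y. Rep_sfun x = y"]) (auto simp: Rep_tderiv)

section \<open>Multi-index binomials and passage through powers\<close>

definition mbinom :: "'d::finite midx \<Rightarrow> 'd midx \<Rightarrow> real"
  where "mbinom k m = (\<Prod>r\<in>UNIV. real (k $ r choose m $ r))"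

lemma mbinom_mfact: "m \<le> k \<Longrightarrow> mbinom k m = mfact k / (mfact m * mfact (k - m))"
  unfolding mbinom_def mfact_def prod.distrib[symmetric] prod_dividef[symmetric]
  by (intro prod.cong refl) (simp add: binomial_fact less_eq_vec_def)

lemma mbinom_eq_0: "\<not> m \<le> k \<Longrightarrow> mbinom k m = 0"
  unfolding mbinom_def less_eq_vec_def by (auto simp: not_le intro: binomial_eq_0)

text \<open>Pascal's rule in coordinate \<open>r\<close>, the other coordinates giving the common
  factor \<open>P\<close>. The case distinction excludes \<open>m $ r = 0\<close>, where the
  truncated \<open>m - axis r 1\<close> would be \<open>m\<close> itself.\<close>

lemma mbinom_add_axis:
  "mbinom (k + axis r 1) m = mbinom k m + (if axis r 1 \<le> m then mbinom k (m - axis r 1) else 0)"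
proof -
  define P where "P = (\<Prod>s\<in>UNIV - {r}. real (k $ s choose m $ s))"
  have split: "mbinom j l = real (j $ r choose l $ r) * (\<Prod>s\<in>UNIV - {r}. real (j $ s choose l $ s))" for j l :: "'a midx"
    unfolding mbinom_def by (rule prod.remove) auto
  have 1: "(\<Prod>s\<in>UNIV - {r}. real ((k + axis r 1) $ s choose m $ s)) = P"
    unfolding P_def by (intro prod.cong) (auto simp: axis_def)
  have 2: "(\<Prod>s\<in>UNIV - {r}. real (k $ s choose (m - axis r 1) $ s)) = P"
    unfolding P_def by (intro prod.cong) (auto simp: axis_def)
  have le: "axis r 1 \<le> m \<longleftrightarrow> m $ r \<noteq> 0"
    unfolding less_eq_vec_def by (auto simp: axis_def)
  show ?thesis
    unfolding split[of _ m] split[of _ "m - axis r 1"] 1 2 P_def[symmetric] le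
    by (cases "m $ r") (simp_all add: axis_def One_nat_def distrib_left mult.commute)
qed

text \<open>Induction on \<open>k\<close> for all shifts \<open>q\<close> at once, since the
  commutator term moves the shift to \<open>q + axis r 1\<close>. The two resulting sums, one kept
  (\<open>A\<close>) and one reindexed by \<open>m + axis r 1\<close> (\<open>B\<close>), combine by
  Pascal's rule.\<close>

lemma cderiv_shift_tpow:
  "cderiv_shift dm a u q (tpow dm k G) =
    (\<Sum>m | m \<le> k. mbinom k m *\<^sub>R tpow dm (k - m) (cderiv_shift dm a u (q + m) G))"
proof (induction k arbitrary: q rule: midx_induct)
  case zero
  have "{m. m \<le> (0 :: 'b midx)} = {0}"
    by (auto simp: less_eq_vec_def vec_eq_iff)
  then show ?case by (simp add: mbinom_def)
next
  case (add k r)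
  let ?e = "axis r 1 :: 'b midx"
  let ?X = "\<lambda>j m. tpow dm j (cderiv_shift dm a u (q + m) G)"
  have A: "(\<Sum>m | m \<le> k + ?e. mbinom k m *\<^sub>R ?X (k + ?e - m) m) =
      (\<Sum>m | m \<le> k. mbinom k m *\<^sub>R tderiv dm r (?X (k - m) m))"
  proof (rule sum.mono_neutral_cong_right)
    show "{m. m \<le> k} \<subseteq> {m. m \<le> k + ?e}"
      by (auto simp: less_eq_vec_def intro: trans_le_add1)
    show "mbinom k m *\<^sub>R ?X (k + ?e - m) m = mbinom k m *\<^sub>R tderiv dm r (?X (k - m) m)"
      if "m \<in> {m. m \<le> k}" for m
    proof -
      have "k + ?e - m = (k - m) + ?e"
        using that by (auto simp: vec_eq_iff less_eq_vec_def)
      then show ?thesis by (simp add: tpow_add_axis)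
    qed
  qed (auto simp: finite_midx_le mbinom_eq_0)
  have B: "(\<Sum>m | m \<le> k + ?e. (if ?e \<le> m then mbinom k (m - ?e) else 0) *\<^sub>R ?X (k + ?e - m) m) =
      (\<Sum>m | m \<le> k. mbinom k m *\<^sub>R ?X (k - m) (?e + m))"
  proof -
    have "(\<Sum>m | m \<le> k + ?e. (if ?e \<le> m then mbinom k (m - ?e) else 0) *\<^sub>R ?X (k + ?e - m) m) =
      (\<Sum>m | m \<le> k + ?e \<and> ?e \<le> m. mbinom k (m - ?e) *\<^sub>R ?X (k + ?e - m) m)"
      by (rule sum.mono_neutral_cong_right) (auto simp: finite_midx_le)
    also have "\<dots> = (\<Sum>m | m \<le> k. mbinom k m *\<^sub>R ?X (k - m) (?e + m))"
    proof (rule sum.reindex_bij_witness[of _ "\<lambda>m. m + ?e" "\<lambda>m. m - ?e"])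
      fix m assume m: "m \<in> {m. m \<le> k + ?e \<and> ?e \<le> m}"
      then have me: "m - ?e + ?e = m" by (simp add: vec_eq_iff less_eq_vec_def)
      show "m - ?e + ?e = m" by (rule me)
      show "m - ?e \<in> {m. m \<le> k}"
        using m by (auto simp: less_eq_vec_def le_diff_conv)
      have "k - (m - ?e) = k + ?e - m"
        using m by (auto simp: vec_eq_iff less_eq_vec_def)
      then show "mbinom k (m - ?e) *\<^sub>R ?X (k - (m - ?e)) (?e + (m - ?e)) =
          mbinom k (m - ?e) *\<^sub>R ?X (k + ?e - m) m"
        using me by (simp add: add.commute)
    qed (auto simp: less_eq_vec_def)
    finally show ?thesis .
  qed
  have "cderiv_shift dm a u q (tpow dm (k + ?e) G) =
      tderiv dm r (cderiv_shift dm a u q (tpow dm k G)) + cderiv_shift dm a u (q + ?e) (tpow dm k G)"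
    by (simp add: tpow_add_axis cderiv_shift_tderiv)
  also have "\<dots> = (\<Sum>m | m \<le> k. mbinom k m *\<^sub>R tderiv dm r (?X (k - m) m)) +
      (\<Sum>m | m \<le> k. mbinom k m *\<^sub>R ?X (k - m) (?e + m))"
    unfolding add.IH by (simp add: linear_sum[OF linear_tderiv] linear_scale[OF linear_tderiv] add.assoc)
  also have "\<dots> = (\<Sum>m | m \<le> k + ?e. mbinom (k + ?e) m *\<^sub>R ?X (k + ?e - m) m)"
    unfolding A[symmetric] B[symmetric] sum.distrib[symmetric] scaleR_add_left[symmetric] mbinom_add_axis ..
  finally show ?case .
qed

lemma cderiv_tpow:
  "cderiv dm a u (tpow dm k G) =
    (\<Sum>m | m \<le> k \<and> m \<le> snd a. mbinom k m *\<^sub>R tpow dm (k - m) (cderiv dm (fst a, snd a - m) u G))"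
proof -
  have "cderiv dm a u (tpow dm k G) = cderiv_shift dm a u 0 (tpow dm k G)"
    by (simp add: cderiv_shift_def less_eq_vec_def)
  also have "\<dots> = (\<Sum>m | m \<le> k \<and> m \<le> snd a. mbinom k m *\<^sub>R tpow dm (k - m) (cderiv dm (fst a, snd a - m) u G))"
    unfolding cderiv_shift_tpow
    by (rule sum.mono_neutral_cong_right)
      (auto simp: finite_midx_le cderiv_shift_def linear_0[OF linear_tpow])
  finally show ?thesis .
qed

lemma sum_PiE_insert:
  fixes h :: "('a \<Rightarrow> 'b) \<Rightarrow> 'c::comm_monoid_add"
  assumes "x \<notin> A"
  shows "(\<Sum>f\<in>PiE (insert x A) B. h f) = (\<Sum>y\<in>B x. \<Sum>f\<in>PiE A B. h (f(x := y)))"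
proof -
  have "inj_on (\<lambda>(y, g). g(x := y)) (B x \<times> PiE A B)"
    by (rule inj_combinator[OF assms])
  then have "(\<Sum>f\<in>PiE (insert x A) B. h f) = (\<Sum>(y, f)\<in>B x \<times> PiE A B. h (f(x := y)))"
    unfolding PiE_insert_eq by (simp add: sum.reindex case_prod_unfold comp_def)
  then show ?thesis by (simp add: sum.cartesian_product)
qed

section \<open>Constant-coefficient derivatives along a multiset of edges\<close>

text \<open>Folding over a multiset is legitimate because derivatives with constant coefficients
  commute. The payload type \<open>'x\<close> stays open: it is a tree in the grafting formulas and
  a vector-valued function in \<open>deriv_eval_eq_cprod\<close>.\<close>

definition cprod ::
    "('k \<Rightarrow> nat) \<Rightarrow> (('k, 'd::finite) edge \<times> 'x \<Rightarrow> nat \<Rightarrow> real) \<Rightarrow> (('k, 'd) edge \<times> 'x) multiset \<Rightarrow>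
     ('k, 'd) sfun \<Rightarrow> ('k, 'd) sfun"
  where "cprod dm u N G = fold_mset (\<lambda>b. cderiv dm (fst b) (u b)) G N"

lemma comp_fun_commute_cderiv: "comp_fun_commute (\<lambda>b. cderiv dm (fst b) (u b))"
  by standard (simp add: fun_eq_iff cderiv_commute)

lemma cprod_empty [simp]: "cprod dm u {#} G = G"
  by (simp add: cprod_def)

lemma cprod_add_mset: "cprod dm u (add_mset b N) G = cderiv dm (fst b) (u b) (cprod dm u N G)"
  by (simp add: cprod_def comp_fun_commute.fold_mset_add_mset[OF comp_fun_commute_cderiv])

lemma cprod_union: "cprod dm u (M + N) G = cprod dm u N (cprod dm u M G)"
  by (simp add: cprod_def comp_fun_commute.fold_mset_union[OF comp_fun_commute_cderiv])

lemma cprod_add_mset_inner: "cprod dm u (add_mset b N) G = cprod dm u N (cderiv dm (fst b) (u b) G)"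
  using cprod_union[of dm u "{#b#}" N G] cprod_add_mset[of dm u b "{#}" G] by simp

lemma linear_cprod: "linear (cprod dm u N)"
  by (induction N)
    (auto simp: linear_iff cprod_add_mset linear_add[OF linear_cderiv] linear_scale[OF linear_cderiv])

lemma cprod_image_mset:
  assumes "\<And>b. b \<in># N \<Longrightarrow> fst (f b) = fst b"
    and "\<And>b c. b \<in># N \<Longrightarrow> c < dm (fst (fst b)) \<Longrightarrow> u (f b) c = v b c"
  shows "cprod dm u (image_mset f N) G = cprod dm v N G"
  using assms
proof (induction N)
  case (add b N)
  have "cderiv dm (fst b) (u (f b)) = cderiv dm (fst b) (v b)"
    by (rule cderiv_cong) (use add.prems in simp)
  then show ?case using add by (simp add: cprod_add_mset)
qed simp

text \<open>At the fixed \<open>Z\<close> the factors are numbers, so linearity moves them inside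
  the derivatives and the sum over component tuples factorizes. The list is taken apart from its end
  because its last edge is the innermost derivative in \<open>foldr\<close>.\<close>

lemma deriv_eval_eq_cprod:
  "deriv_eval dm k avs (Rep_sfun G) Z = Rep_sfun (tpow dm k (cprod dm (\<lambda>b c. snd b c Z) (mset avs) G)) Z"
proof (induction avs arbitrary: G rule: rev_induct)
  case Nil
  then show ?case by (simp add: deriv_eval_def Rep_tpow)
next
  case (snoc av avs)
  let ?n = "length avs"
  let ?B = "\<lambda>avs j. {..<dm (fst (fst (avs ! j)))}"
  let ?f = "\<lambda>avs c G. multi_power (total_deriv dm) k (foldr (\<lambda>j. partial (fst (avs ! j)) (c j)) [0..<length avs] G) Z
       * (\<Prod>j<length avs. snd (avs ! j) (c j) Z)"
  have foldr: "foldr (\<lambda>j. partial (fst ((avs @ [av]) ! j)) ((c(?n := y)) j)) [0..<Suc ?n] G =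
      foldr (\<lambda>j. partial (fst (avs ! j)) (c j)) [0..<?n] (partial (fst av) y G)" for c y G
    by (auto intro!: foldr_cong simp: nth_append)
  have prod: "(\<Prod>j<Suc ?n. snd ((avs @ [av]) ! j) ((c(?n := y)) j) Z) =
      (\<Prod>j<?n. snd (avs ! j) (c j) Z) * snd av y Z" for c y
    by (auto intro!: arg_cong2[where f = "(*)"] prod.cong simp: nth_append)
  have B: "PiE {..<?n} (?B (avs @ [av])) = PiE {..<?n} (?B avs)"
    by (rule PiE_cong) (simp add: nth_append)
  have "deriv_eval dm k (avs @ [av]) (Rep_sfun G) Z =
      (\<Sum>y<dm (fst (fst av)). \<Sum>c\<in>PiE {..<?n} (?B avs). ?f (avs @ [av]) (c(?n := y)) (Rep_sfun G))"
    unfolding deriv_eval_def length_append_singleton lessThan_Suc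
    by (subst sum_PiE_insert) (auto simp: B)
  also have "\<dots> = (\<Sum>y<dm (fst (fst av)). snd av y Z * deriv_eval dm k avs (Rep_sfun (vderiv (fst av) y G)) Z)"
    unfolding length_append_singleton foldr prod
    by (simp add: deriv_eval_def sum_distrib_left vderiv.rep_eq mult_ac)
  also have "\<dots> = Rep_sfun (tpow dm k (cprod dm (\<lambda>b c. snd b c Z) (mset (avs @ [av])) G)) Z"
    unfolding snoc.IH
    by (simp add: cprod_add_mset_inner cderiv_def[of dm "fst av"] linear_sum[OF linear_cprod] linear_sum[OF linear_tpow]
        linear_scale[OF linear_cprod] linear_scale[OF linear_tpow] Rep_sfun_sum Rep_sfun_scaleR)
  finally show ?case .
qed

section \<open>Trees with operators at the nodes\<close>

primrec root_noise :: "('a, 'n, 'e) tree \<Rightarrow> 'n option"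
  where "root_noise (Node v l M) = l"

definition distinct_nodes :: "('a, 'n, 'e) tree \<Rightarrow> bool"
  where "distinct_nodes s \<longleftrightarrow> (\<forall>v. count (node_mset s) v \<le> 1)"

text \<open>Splitting off one branch at a time turns the product over all branches into a product of
  two factors, to which the Leibniz rule applies directly.\<close>

lemma tree_add_branch_induct [case_names leaf branch]:
  assumes "\<And>v l. P (Node v l {#})"
    and "\<And>v l a t M. P t \<Longrightarrow> P (Node v l M) \<Longrightarrow> P (Node v l (add_mset (a, t) M))"
  shows "P s"
proof (induction s)
  case (Node v l M)
  then show ?case
  proof (induction M)
    case empty
    show ?case by (rule assms(1))
  next
    case (add b M)
    obtain a t where b: "b = (a, t)" by (cases b)
    have "P t" using add.prems[of b t] b by (simp add: snds.simps)
    moreover have "P (Node v l M)"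
      by (rule add.IH) (use add.prems in auto)
    ultimately show ?case unfolding b by (rule assms(2))
  qed
qed

lemma node_mset_add_branch:
  "node_mset (Node v l (add_mset (a, t) M)) = node_mset t + node_mset (Node v l M)"
  by simp

lemma nodes_add_branch: "nodes (Node v l (add_mset (a, t) M)) = nodes t \<union> nodes (Node v l M)"
  unfolding set_node_mset[symmetric] node_mset_add_branch by simp

lemma finite_nodes [simp]: "finite (nodes s)"
  unfolding set_node_mset[symmetric] by simp

text \<open>Changing the operator at one node thus affects one of the two factors in
  \<open>rop_add_branch\<close> and leaves the other alone.\<close>

lemma distinct_nodes_add_branch:
  assumes "distinct_nodes (Node v l (add_mset (a, t) M))"
  shows "distinct_nodes t" "distinct_nodes (Node v l M)" "nodes t \<inter> nodes (Node v l M) = {}"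
proof -
  have c: "count (node_mset t) w + count (node_mset (Node v l M)) w \<le> 1" for w
    using assms unfolding distinct_nodes_def node_mset_add_branch count_union by blast
  show "distinct_nodes t" "distinct_nodes (Node v l M)"
    unfolding distinct_nodes_def using c by (meson add_leE)+
  have False if "w \<in># node_mset t" "w \<in># node_mset (Node v l M)" for w
    using c[of w] that unfolding count_greater_zero_iff[symmetric] by linarith
  then show "nodes t \<inter> nodes (Node v l M) = {}"
    unfolding set_node_mset[symmetric] by blast
qed

text \<open>A fold over operators \<open>K\<close> instead of functions: a branch puts its
  derivative inside \<open>K\<close> but its value outside, so the operator at the node does not act
  on the values of the branches.\<close>

definition bstep ::
    "('k \<Rightarrow> nat) \<Rightarrow> ('k, 'd::finite) edge \<times> (nat \<Rightarrow> ('k, 'd) sfun) \<Rightarrow>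
     (('k, 'd) sfun \<Rightarrow> ('k, 'd) sfun) \<Rightarrow> ('k, 'd) sfun \<Rightarrow> ('k, 'd) sfun"
  where "bstep dm b K G = (\<Sum>c<dm (fst (fst b)). snd b c * K (vderiv (fst b) c G))"

lemma comp_fun_commute_bstep: "comp_fun_commute (bstep dm)"
proof (standard, intro ext)
  fix a b :: "('a, 'b) edge \<times> (nat \<Rightarrow> ('a, 'b) sfun)" and K G
  show "(bstep dm a \<circ> bstep dm b) K G = (bstep dm b \<circ> bstep dm a) K G"
    unfolding bstep_def comp_def sum_distrib_left
    by (subst sum.swap) (intro sum.cong refl, simp add: vderiv_commute[of "fst a"] mult.left_commute)
qed

text \<open>
  \<open>rop dm F \<Phi> s G\<close> is \<open>F\<^sub>i(s)\<close> with the operator \<open>\<Phi> v\<close> in place of \<open>\<partial>\<^bsup>\<nn>\<^sub>v\<^esup>\<close> at each node \<open>v\<close> and with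
  \<open>G\<close> in place of \<open>F\<^sub>i\<^sup>l\<close> at the root.
\<close>

primrec rop ::
    "('k \<Rightarrow> nat) \<Rightarrow> ('k \<Rightarrow> 'n option \<Rightarrow> nat \<Rightarrow> ('k, 'd::finite) sfun) \<Rightarrow>
     ('a \<Rightarrow> ('k, 'd) sfun \<Rightarrow> ('k, 'd) sfun) \<Rightarrow> ('a, 'n, ('k, 'd) edge) tree \<Rightarrow> ('k, 'd) sfun \<Rightarrow> ('k, 'd) sfun"
  where "rop dm F \<Phi> (Node v l M) = fold_mset (bstep dm) (\<Phi> v)
    (image_mset (\<lambda>(a, t, f). (a, \<lambda>c. f (F (fst a) (root_noise t) c)))
      (image_mset (map_prod id (\<lambda>t. (t, rop dm F \<Phi> t))) M))"

lemma rop_leaf: "rop dm F \<Phi> (Node v l {#}) G = \<Phi> v G"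
  by simp

lemma rop_add_branch:
  "rop dm F \<Phi> (Node v l (add_mset (a, t) M)) G =
    (\<Sum>c<dm (fst a). rop dm F \<Phi> t (F (fst a) (root_noise t) c) * rop dm F \<Phi> (Node v l M) (vderiv a c G))"
  by (simp add: comp_fun_commute.fold_mset_add_mset[OF comp_fun_commute_bstep] bstep_def)

declare rop.simps [simp del]

lemma rop_cong:
  "(\<And>w. w \<in> nodes s \<Longrightarrow> \<Phi> w = \<Psi> w) \<Longrightarrow> rop dm F \<Phi> s G = rop dm F \<Psi> s G"
proof (induction s arbitrary: G rule: tree_add_branch_induct)
  case (leaf v l)
  then show ?case by (simp add: rop_leaf)
next
  case (branch v l a t M)
  have "rop dm F \<Phi> t H = rop dm F \<Psi> t H" "rop dm F \<Phi> (Node v l M) H = rop dm F \<Psi> (Node v l M) H" for H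
    using branch.IH branch.prems unfolding nodes_add_branch by blast+
  then show ?case unfolding rop_add_branch by simp
qed

lemma rop_upd_outside: "w \<notin> nodes s \<Longrightarrow> rop dm F (\<Phi>(w := A)) s G = rop dm F \<Phi> s G"
  by (rule rop_cong) auto

text \<open>The Leibniz rule in both factors of \<open>rop_add_branch\<close>: \<open>A\<close>
  reaches either a node of the split-off branch (\<open>1\<close>) or one of the remaining tree
  (\<open>2\<close>).\<close>

lemma rop_derivation:
  assumes A: "derivation A" and "distinct_nodes s"
  shows "A (rop dm F \<Phi> s G) = (\<Sum>w\<in>nodes s. rop dm F (\<Phi>(w := \<lambda>G. A (\<Phi> w G))) s G)"
  using assms(2)
proof (induction s arbitrary: G rule: tree_add_branch_induct)
  case (leaf v l)
  then show ?case by (simp add: rop_leaf)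
next
  case (branch v l a t M)
  let ?s = "Node v l M" and ?F = "F (fst a) (root_noise t)"
  note d = distinct_nodes_add_branch[OF branch.prems]
  let ?U = "\<lambda>w. \<Phi>(w := \<lambda>G. A (\<Phi> w G))"
  have 1: "(\<Sum>c<dm (fst a). A (rop dm F \<Phi> t (?F c)) * rop dm F \<Phi> ?s (vderiv a c G)) =
      (\<Sum>w\<in>nodes t. rop dm F (?U w) (Node v l (add_mset (a, t) M)) G)"
  proof -
    have "(\<Sum>c<dm (fst a). A (rop dm F \<Phi> t (?F c)) * rop dm F \<Phi> ?s (vderiv a c G)) =
        (\<Sum>w\<in>nodes t. \<Sum>c<dm (fst a). rop dm F (?U w) t (?F c) * rop dm F \<Phi> ?s (vderiv a c G))"
      unfolding branch.IH(1)[OF d(1)] sum_distrib_right by (rule sum.swap)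
    also have "\<dots> = (\<Sum>w\<in>nodes t. rop dm F (?U w) (Node v l (add_mset (a, t) M)) G)"
      unfolding rop_add_branch
      by (intro sum.cong refl arg_cong2[where f = "(*)"] rop_upd_outside[symmetric]) (use d(3) in blast)
    finally show ?thesis .
  qed
  have 2: "(\<Sum>c<dm (fst a). rop dm F \<Phi> t (?F c) * A (rop dm F \<Phi> ?s (vderiv a c G))) =
      (\<Sum>w\<in>nodes ?s. rop dm F (?U w) (Node v l (add_mset (a, t) M)) G)"
  proof -
    have "(\<Sum>c<dm (fst a). rop dm F \<Phi> t (?F c) * A (rop dm F \<Phi> ?s (vderiv a c G))) =
        (\<Sum>w\<in>nodes ?s. \<Sum>c<dm (fst a). rop dm F \<Phi> t (?F c) * rop dm F (?U w) ?s (vderiv a c G))"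
      unfolding branch.IH(2)[OF d(2)] sum_distrib_left by (rule sum.swap)
    also have "\<dots> = (\<Sum>w\<in>nodes ?s. rop dm F (?U w) (Node v l (add_mset (a, t) M)) G)"
      unfolding rop_add_branch
      by (intro sum.cong refl arg_cong2[where f = "(*)"] rop_upd_outside[symmetric]) (use d(3) in blast)
    finally show ?thesis .
  qed
  have "A (rop dm F \<Phi> (Node v l (add_mset (a, t) M)) G) =
      (\<Sum>c<dm (fst a). rop dm F \<Phi> t (?F c) * A (rop dm F \<Phi> ?s (vderiv a c G))) +
      (\<Sum>c<dm (fst a). A (rop dm F \<Phi> t (?F c)) * rop dm F \<Phi> ?s (vderiv a c G))"
    unfolding rop_add_branch linear_sum[OF derivation_linear[OF A]] derivation_mult[OF A] sum.distrib ..
  then show ?case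
    unfolding 1 2 nodes_add_branch sum.union_disjoint[OF finite_nodes finite_nodes d(3)]
    by (simp only: add.commute)
qed

text \<open>Names are distinct, so the operator at \<open>w\<close> occurs once in each product and
  a linear combination there can be pulled out.\<close>

lemma rop_node_linear:
  assumes "distinct_nodes s" "w \<in> nodes s"
  shows "rop dm F (\<Phi>(w := \<lambda>G. \<Sum>j\<in>J. q j *\<^sub>R \<Psi> j G)) s G =
    (\<Sum>j\<in>J. q j *\<^sub>R rop dm F (\<Phi>(w := \<Psi> j)) s G)"
  using assms
proof (induction s arbitrary: G rule: tree_add_branch_induct)
  case (leaf v l)
  then show ?case by (simp add: rop_leaf)
next
  case (branch v l a t M)
  let ?s = "Node v l M" and ?F = "F (fst a) (root_noise t)"
  note d = distinct_nodes_add_branch[OF branch.prems(1)]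
  show ?case
  proof (cases "w \<in> nodes t")
    case True
    then have w: "w \<notin> nodes ?s" using d(3) by blast
    show ?thesis
      unfolding rop_add_branch rop_upd_outside[OF w] branch.IH(1)[OF d(1) True]
        sum_distrib_right scaleR_sum_right mult_scaleR_left
      by (rule sum.swap)
  next
    case False
    then have w: "w \<in> nodes ?s" using branch.prems(2) unfolding nodes_add_branch by blast
    show ?thesis
      unfolding rop_add_branch rop_upd_outside[OF False] branch.IH(2)[OF d(2) w]
        sum_distrib_left scaleR_sum_right mult_scaleR_right
      by (rule sum.swap)
  qed
qed

text \<open>At a fixed \<open>Z\<close> the values of the branches, which stand outside
  \<open>\<Phi> v\<close>, are numbers; linearity of \<open>\<Phi> v\<close> moves them inside,
  where they become frozen directions.\<close>

lemma Rep_rop: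
  assumes "linear (\<Phi> v)"
  shows "Rep_sfun (rop dm F \<Phi> (Node v l M) G) Z = Rep_sfun (\<Phi> v (cprod dm
    (\<lambda>b c. Rep_sfun (rop dm F \<Phi> (snd b) (F (fst (fst b)) (root_noise (snd b)) c)) Z) M G)) Z"
proof (induction M arbitrary: G)
  case empty
  then show ?case by (simp add: rop_leaf)
next
  case (add b M)
  obtain a t where b: "b = (a, t)" by (cases b)
  show ?case
    unfolding b rop_add_branch
    by (simp add: Rep_sfun_sum times_sfun.rep_eq add.IH cprod_add_mset_inner cderiv_def[of dm a]
        linear_sum[OF linear_cprod] linear_sum[OF assms] linear_scale[OF linear_cprod]
        linear_scale[OF assms] Rep_sfun_scaleR)
qed

text \<open>Subtrees enter only through their values at \<open>Z\<close>, so it suffices to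
  represent the root function as an \<open>sfun\<close>. The chosen enumeration disappears because
  \<open>cprod\<close> folds over the multiset.\<close>

lemma elem_diff_Node:
  assumes F': "Rep_sfun (F' i l c) = F i l c"
  shows "elem_diff dm F (Node k l N) i c Z =
    Rep_sfun (tpow dm k (cprod dm (\<lambda>b c. elem_diff dm F (snd b) (fst (fst b)) c Z) N (F' i l c))) Z"
proof -
  have "elem_diff dm F (Node k l N) i c Z = Rep_sfun (tpow dm k (cprod dm (\<lambda>b c. snd b c Z)
      (image_mset (\<lambda>b. (fst b, elem_diff dm F (snd b) (fst (fst b)))) N) (F' i l c))) Z"
    by (simp add: F'[symmetric] deriv_eval_eq_cprod multiset.map_comp comp_def case_prod_unfold)
  also have "cprod dm (\<lambda>b c. snd b c Z)
      (image_mset (\<lambda>b. (fst b, elem_diff dm F (snd b) (fst (fst b)))) N) (F' i l c) =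
      cprod dm (\<lambda>b c. elem_diff dm F (snd b) (fst (fst b)) c Z) N (F' i l c)"
    by (rule cprod_image_mset) auto
  finally show ?thesis .
qed

text \<open>The branches of \<open>s\<close> remain functions inside \<open>rop\<close>, while the
  grafted ones enter as constants. The two sides agree at the very point \<open>Z\<close> where
  these constants were taken.\<close>

lemma elem_diff_decorate_graft:
  assumes F': "\<And>i l c. c < dm i \<Longrightarrow> Rep_sfun (F' i l c) = F i l c" and "c < dm i"
  shows "elem_diff dm F (decorate_graft h g s) i c Z =
    Rep_sfun (rop dm F' (\<lambda>w G. tpow dm (h w)
      (cprod dm (\<lambda>b c. elem_diff dm F (snd b) (fst (fst b)) c Z) (g w) G)) s (F' i (root_noise s) c)) Z"
  using assms(2)
proof (induction s arbitrary: i c)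
  case (Node v l M)
  let ?u = "\<lambda>b c. elem_diff dm F (snd b) (fst (fst b)) c Z"
  let ?\<Phi> = "\<lambda>w G. tpow dm (h w) (cprod dm ?u (g w) G)"
  let ?v = "\<lambda>b c. Rep_sfun (rop dm F' ?\<Phi> (snd b) (F' (fst (fst b)) (root_noise (snd b)) c)) Z"
  have lin: "linear (?\<Phi> v)"
    using linear_compose[OF linear_cprod linear_tpow] by (simp add: comp_def)
  have "cprod dm ?u (image_mset (map_prod id (decorate_graft h g)) M) (F' i l c) = cprod dm ?v M (F' i l c)"
  proof (rule cprod_image_mset)
    fix b e assume b: "b \<in># M" "e < dm (fst (fst b))"
    have "elem_diff dm F (decorate_graft h g (snd b)) (fst (fst b)) e Z = ?v b e"
      by (rule Node.IH[OF b(1) _ b(2)]) (simp add: snds.simps)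
    then show "?u (map_prod id (decorate_graft h g) b) e = ?v b e" by simp
  qed simp
  then have "elem_diff dm F (decorate_graft h g (Node v l M)) i c Z =
      Rep_sfun (?\<Phi> v (cprod dm ?v M (F' i l c))) Z"
    by (simp add: elem_diff_Node[of F' i l c F, OF F'[OF Node.prems]] cprod_union del: elem_diff.simps)
  then show ?case
    unfolding Rep_rop[of ?\<Phi> v, OF lin] by simp
qed

section \<open>Grafting and raising\<close>

text \<open>
  The value of the tree \<open>decorate_graft h g s\<close>, the derivatives \<open>u\<close> along the grafted branches
  being frozen to constants so that derivations do not act on them.
\<close>

definition frozen ::
    "('k \<Rightarrow> nat) \<Rightarrow> ('k \<Rightarrow> 'n option \<Rightarrow> nat \<Rightarrow> ('k, 'd::{finite,linorder}) sfun) \<Rightarrow>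
     ('k \<Rightarrow> 'x \<Rightarrow> nat \<Rightarrow> real) \<Rightarrow> ('a, 'n, ('k, 'd) edge) tree \<Rightarrow> ('k, 'd) sfun \<Rightarrow>
     ('a \<Rightarrow> 'd midx) \<Rightarrow> ('a \<Rightarrow> (('k, 'd) edge \<times> 'x) multiset) \<Rightarrow> ('k, 'd) sfun"
  where "frozen dm F u s G h g =
    rop dm F (\<lambda>w G. tpow dm (h w) (cprod dm (\<lambda>b. u (fst (fst b)) (snd b)) (g w) G)) s G"

text \<open>Grafted branches are constants here, so the Leibniz rule visits only the nodes of
  \<open>s\<close>, just as raising does.\<close>

lemma tderiv_frozen:
  assumes "distinct_nodes s"
  shows "tderiv dm r (frozen dm F u s G h g) = (\<Sum>w\<in>nodes s. frozen dm F u s G (h(w := h w + axis r 1)) g)"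
  unfolding frozen_def rop_derivation[OF derivation_tderiv assms]
  by (intro sum.cong refl rop_cong) (simp add: tpow_add_axis)

text \<open>One grafting step: the Leibniz rule chooses the node \<open>w\<close>, and passing
  through the power at \<open>w\<close> lowers both its decoration and the new edge by
  \<open>m\<close>, with a binomial weight.\<close>

lemma cderiv_frozen:
  assumes s: "distinct_nodes s"
  shows "cderiv dm a (u (fst a) x) (frozen dm F u s G h g) =
    (\<Sum>w\<in>nodes s. \<Sum>m | m \<le> h w \<and> m \<le> snd a. mbinom (h w) m *\<^sub>R
       frozen dm F u s G (h(w := h w - m)) (g(w := add_mset ((fst a, snd a - m), x) (g w))))"
proof -
  let ?u = "\<lambda>b. u (fst (fst b)) (snd b)"
  let ?\<Phi> = "\<lambda>h g w G. tpow dm (h w) (cprod dm ?u (g w) G)"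
  let ?\<Psi> = "\<lambda>w m G. tpow dm (h w - m) (cprod dm ?u (add_mset ((fst a, snd a - m), x) (g w)) G)"
  have *: "(\<lambda>G. cderiv dm a (u (fst a) x) (?\<Phi> h g w G)) =
      (\<lambda>G. \<Sum>m | m \<le> h w \<and> m \<le> snd a. mbinom (h w) m *\<^sub>R ?\<Psi> w m G)" for w
    by (simp add: cderiv_tpow cprod_add_mset)
  have upd: "(?\<Phi> h g)(w := ?\<Psi> w m) =
      ?\<Phi> (h(w := h w - m)) (g(w := add_mset ((fst a, snd a - m), x) (g w)))" for w m
    by (auto simp: fun_eq_iff)
  have "cderiv dm a (u (fst a) x) (frozen dm F u s G h g) =
      (\<Sum>w\<in>nodes s. rop dm F ((?\<Phi> h g)(w := \<lambda>G. cderiv dm a (u (fst a) x) (?\<Phi> h g w G))) s G)"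
    unfolding frozen_def by (rule rop_derivation[OF derivation_cderiv s])
  also have "\<dots> = (\<Sum>w\<in>nodes s. \<Sum>m | m \<le> h w \<and> m \<le> snd a.
      mbinom (h w) m *\<^sub>R rop dm F ((?\<Phi> h g)(w := ?\<Psi> w m)) s G)"
    unfolding * by (intro sum.cong refl rop_node_linear s)
  finally show ?thesis unfolding upd frozen_def .
qed

section \<open>The grafting sum, one branch at a time\<close>

lemma sum_upd_less_Suc:
  fixes f :: "nat \<Rightarrow> 'b::comm_monoid_add"
  shows "(\<Sum>i | i < Suc n \<and> (v(n := w0)) i = w. (f(n := y)) i) =
    (\<Sum>i | i < n \<and> v i = w. f i) + (if w = w0 then y else 0)"
proof -
  have eq: "{i. i < Suc n \<and> (v(n := w0)) i = w} =
      (if w = w0 then insert n {i. i < n \<and> v i = w} else {i. i < n \<and> v i = w})"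
    by (auto simp: less_Suc_eq)
  have "(\<Sum>i | i < n \<and> v i = w. (f(n := y)) i) = (\<Sum>i | i < n \<and> v i = w. f i)"
    by (rule sum.cong) auto
  then show ?thesis
    unfolding eq by (auto simp: add.commute)
qed

lemma prod_upd_less_Suc:
  fixes f :: "'c \<Rightarrow> 'b::comm_monoid_mult"
  shows "(\<Prod>i | i < Suc n \<and> (v(n := w0)) i = w. f ((m(n := y)) i)) =
    (\<Prod>i | i < n \<and> v i = w. f (m i)) * (if w = w0 then f y else 1)"
proof -
  have eq: "{i. i < Suc n \<and> (v(n := w0)) i = w} =
      (if w = w0 then insert n {i. i < n \<and> v i = w} else {i. i < n \<and> v i = w})"
    by (auto simp: less_Suc_eq)
  have "(\<Prod>i | i < n \<and> v i = w. f ((m(n := y)) i)) = (\<Prod>i | i < n \<and> v i = w. f (m i))"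
    by (rule prod.cong) auto
  then show ?thesis
    unfolding eq by (auto simp: mult.commute)
qed

text \<open>The conditions under which a summand of \<open>graft\<close> survives are moved into the
  index set, which can then be extended by one branch.\<close>

definition graft_index ::
    "(('k, 'd::finite) edge \<times> 'x) list \<Rightarrow> nat set \<Rightarrow> (nat \<Rightarrow> 'd midx) \<Rightarrow> ((nat \<Rightarrow> nat) \<times> (nat \<Rightarrow> 'd midx)) set"
  where "graft_index bs N \<nn> = {(v, m). v \<in> {..<length bs} \<rightarrow>\<^sub>E N \<and> m \<in> {..<length bs} \<rightarrow>\<^sub>E UNIV \<and>
    (\<forall>w\<in>N. (\<Sum>i | i < length bs \<and> v i = w. m i) \<le> \<nn> w) \<and> (\<forall>i<length bs. m i \<le> snd (fst (bs ! i)))}"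

definition graft_coeff :: "nat \<Rightarrow> nat set \<Rightarrow> (nat \<Rightarrow> 'd::finite midx) \<Rightarrow> (nat \<Rightarrow> nat) \<times> (nat \<Rightarrow> 'd midx) \<Rightarrow> real"
  where "graft_coeff n N \<nn> = (\<lambda>(v, m). \<Prod>w\<in>N. mfact (\<nn> w) /
    (mfact (\<nn> w - (\<Sum>i | i < n \<and> v i = w. m i)) * (\<Prod>i | i < n \<and> v i = w. mfact (m i))))"

definition graft_label :: "nat \<Rightarrow> (nat \<Rightarrow> 'd::finite midx) \<Rightarrow> (nat \<Rightarrow> nat) \<times> (nat \<Rightarrow> 'd midx) \<Rightarrow> nat \<Rightarrow> 'd midx"
  where "graft_label n \<nn> = (\<lambda>(v, m) w. \<nn> w - (\<Sum>i | i < n \<and> v i = w. m i))"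

definition graft_branches ::
    "(('k, 'd::finite) edge \<times> 'x) list \<Rightarrow> (nat \<Rightarrow> nat) \<times> (nat \<Rightarrow> 'd midx) \<Rightarrow> nat \<Rightarrow> (('k, 'd) edge \<times> 'x) multiset"
  where "graft_branches bs = (\<lambda>(v, m) w. image_mset
    (\<lambda>i. ((fst (fst (bs ! i)), snd (fst (bs ! i)) - m i), snd (bs ! i)))
    (mset_set {i. i < length bs \<and> v i = w}))"

lemma zero_le_midx [simp]: "0 \<le> (k :: 'd::finite midx)"
  by (simp add: less_eq_vec_def)

lemma mfact_nonzero [simp]: "mfact k \<noteq> 0"
  by (simp add: mfact_def)

lemma graft_label_snoc:
  "graft_label (Suc n) \<nn> (v(n := w), m(n := y)) = (graft_label n \<nn> (v, m))(w := graft_label n \<nn> (v, m) w - y)"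
proof
  fix w'
  have "a - (b + c) = a - b - c" for a b c :: "'a midx"
    by (simp add: vec_eq_iff)
  then show "graft_label (Suc n) \<nn> (v(n := w), m(n := y)) w' =
      ((graft_label n \<nn> (v, m))(w := graft_label n \<nn> (v, m) w - y)) w'"
    unfolding graft_label_def case_prod_conv sum_upd_less_Suc by simp
qed

lemma graft_branches_snoc:
  assumes n: "n = length bs"
  shows "graft_branches (bs @ [b]) (v(n := w), m(n := y)) = (graft_branches bs (v, m))
    (w := add_mset ((fst (fst b), snd (fst b) - y), snd b) (graft_branches bs (v, m) w))"
proof
  fix w'
  let ?I = "{i. i < n \<and> v i = w'}"
  have eq: "{i. i < length (bs @ [b]) \<and> (v(n := w)) i = w'} = (if w' = w then insert n ?I else ?I)"
    by (auto simp: less_Suc_eq n)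
  have "image_mset (\<lambda>i. ((fst (fst ((bs @ [b]) ! i)), snd (fst ((bs @ [b]) ! i)) - (m(n := y)) i), snd ((bs @ [b]) ! i)))
      (mset_set ?I) = graft_branches bs (v, m) w'"
    unfolding graft_branches_def case_prod_conv n
    by (rule image_mset_cong) (auto simp: nth_append)
  then show "graft_branches (bs @ [b]) (v(n := w), m(n := y)) w' = ((graft_branches bs (v, m))
      (w := add_mset ((fst (fst b), snd (fst b) - y), snd b) (graft_branches bs (v, m) w))) w'"
    unfolding graft_branches_def[of "bs @ [b]"] case_prod_conv eq by (auto simp: n)
qed

text \<open>Only the factor at \<open>w\<close> changes. The binomial of what is left of its
  decoration cancels the old remainder factorial and supplies the new one together with
  \<open>mfact y\<close>.\<close>

lemma graft_coeff_snoc: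
  assumes "finite N" "w \<in> N" "y \<le> graft_label n \<nn> (v, m) w"
  shows "graft_coeff (Suc n) N \<nn> (v(n := w), m(n := y)) =
    graft_coeff n N \<nn> (v, m) * mbinom (graft_label n \<nn> (v, m) w) y"
proof -
  let ?S = "\<lambda>w. \<Sum>i | i < n \<and> v i = w. m i" and ?P = "\<lambda>w. \<Prod>i | i < n \<and> v i = w. mfact (m i)"
  have sub: "a - (b + c) = a - b - c" for a b c :: "'a midx"
    by (simp add: vec_eq_iff)
  have "graft_coeff (Suc n) N \<nn> (v(n := w), m(n := y)) =
      (mfact (\<nn> w) / (mfact (\<nn> w - ?S w - y) * (?P w * mfact y))) *
      (\<Prod>w'\<in>N - {w}. mfact (\<nn> w') / (mfact (\<nn> w' - ?S w') * ?P w'))"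
    unfolding graft_coeff_def case_prod_conv sum_upd_less_Suc prod_upd_less_Suc
    using assms(1,2) by (simp add: prod.remove[of N w] sub)
  moreover have "graft_coeff n N \<nn> (v, m) = (mfact (\<nn> w) / (mfact (\<nn> w - ?S w) * ?P w)) *
      (\<Prod>w'\<in>N - {w}. mfact (\<nn> w') / (mfact (\<nn> w' - ?S w') * ?P w'))"
    unfolding graft_coeff_def case_prod_conv using assms(1,2) by (simp add: prod.remove[of N w])
  ultimately show ?thesis
    using mbinom_mfact[OF assms(3)] by (simp add: graft_label_def)
qed

lemma mem_graft_index_snoc:
  assumes n: "n = length bs" and v: "v \<in> {..<n} \<rightarrow>\<^sub>E N" and m: "m \<in> {..<n} \<rightarrow>\<^sub>E UNIV" and w: "w \<in> N"
  shows "(v(n := w), m(n := y)) \<in> graft_index (bs @ [b]) N \<nn> \<longleftrightarrow>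
    (v, m) \<in> graft_index bs N \<nn> \<and> y \<le> graft_label n \<nn> (v, m) w \<and> y \<le> snd (fst b)"
proof -
  have len: "length (bs @ [b]) = Suc n" by (simp add: n)
  have "v(n := w) \<in> {..<Suc n} \<rightarrow>\<^sub>E N" "m(n := y) \<in> {..<Suc n} \<rightarrow>\<^sub>E UNIV"
    using v m w by (auto simp: lessThan_Suc intro!: PiE_fun_upd)
  moreover have "(\<forall>w'\<in>N. (\<Sum>i | i < n \<and> v i = w'. m i) + (if w' = w then y else 0) \<le> \<nn> w') \<longleftrightarrow>
      (\<forall>w'\<in>N. (\<Sum>i | i < n \<and> v i = w'. m i) \<le> \<nn> w') \<and> y \<le> \<nn> w - (\<Sum>i | i < n \<and> v i = w. m i)"
    using w by (auto simp: midx_le_add_iff)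
  moreover have "(\<forall>i<Suc n. (m(n := y)) i \<le> snd (fst ((bs @ [b]) ! i))) \<longleftrightarrow>
      (\<forall>i<n. m i \<le> snd (fst (bs ! i))) \<and> y \<le> snd (fst b)"
    by (auto simp: less_Suc_eq nth_append n)
  ultimately show ?thesis
    unfolding graft_index_def mem_Collect_eq case_prod_conv len sum_upd_less_Suc graft_label_def n[symmetric]
    using v m by blast
qed

lemma finite_graft_index:
  assumes "finite N"
  shows "finite (graft_index bs N \<nn>)"
proof (rule finite_subset)
  show "graft_index bs N \<nn> \<subseteq> ({..<length bs} \<rightarrow>\<^sub>E N) \<times> PiE {..<length bs} (\<lambda>i. {m. m \<le> snd (fst (bs ! i))})"
    unfolding graft_index_def PiE_def Pi_def lessThan_iff by blast
  show "finite (({..<length bs} \<rightarrow>\<^sub>E N) \<times> PiE {..<length bs} (\<lambda>i. {m. m \<le> snd (fst (bs ! i))}))"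
    by (intro finite_cartesian_product finite_PiE finite_lessThan assms finite_midx_le)
qed

lemma sum_graft_index_snoc:
  fixes f :: "(nat \<Rightarrow> nat) \<times> (nat \<Rightarrow> 'd::finite midx) \<Rightarrow> 'c::comm_monoid_add"
  assumes n: "n = length bs" and N: "finite N"
  shows "(\<Sum>p\<in>graft_index (bs @ [b]) N \<nn>. f p) =
    (\<Sum>(v, m)\<in>graft_index bs N \<nn>. \<Sum>w\<in>N. \<Sum>y | y \<le> graft_label n \<nn> (v, m) w \<and> y \<le> snd (fst b).
       f (v(n := w), m(n := y)))"
proof -
  let ?Y = "\<lambda>p w. {y. y \<le> graft_label n \<nn> p w \<and> y \<le> snd (fst b)}"
  let ?D = "SIGMA p : graft_index bs N \<nn>. SIGMA w : N. ?Y p w"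
  have "(\<Sum>p\<in>graft_index bs N \<nn>. \<Sum>w\<in>N. \<Sum>y\<in>?Y p w. f ((fst p)(n := w), (snd p)(n := y))) =
      (\<Sum>(p, w, y)\<in>?D. f ((fst p)(n := w), (snd p)(n := y)))"
  proof -
    have fY: "finite (?Y p w)" for p w
      by (rule finite_subset[OF _ finite_midx_le]) auto
    have "(\<Sum>w\<in>N. \<Sum>y\<in>?Y p w. f ((fst p)(n := w), (snd p)(n := y))) =
        (\<Sum>(w, y)\<in>Sigma N (?Y p). f ((fst p)(n := w), (snd p)(n := y)))" for p
      by (rule sum.Sigma[OF N]) (use fY in blast)
    then have "(\<Sum>p\<in>graft_index bs N \<nn>. \<Sum>w\<in>N. \<Sum>y\<in>?Y p w. f ((fst p)(n := w), (snd p)(n := y))) =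
        (\<Sum>p\<in>graft_index bs N \<nn>. \<Sum>(w, y)\<in>Sigma N (?Y p). f ((fst p)(n := w), (snd p)(n := y)))"
      by simp
    also have "\<dots> = (\<Sum>(p, w, y)\<in>?D. f ((fst p)(n := w), (snd p)(n := y)))"
      by (rule sum.Sigma[OF finite_graft_index[OF N]]) (use N fY in blast)
    finally show ?thesis .
  qed
  also have "\<dots> = (\<Sum>p\<in>graft_index (bs @ [b]) N \<nn>. f p)"
  \<comment> \<open>The new index splits into its values at \<open>n\<close> and the old families,
    which as extensional functions must be \<open>undefined\<close> at \<open>n\<close>.\<close>
  proof (rule sum.reindex_bij_witness[of _
        "\<lambda>(v, m). ((v(n := undefined), m(n := undefined)), v n, m n)"
        "\<lambda>(p, w, y). ((fst p)(n := w), (snd p)(n := y))"])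
    fix q assume q: "q \<in> ?D"
    obtain v m w y where [simp]: "q = ((v, m), w, y)" by (metis prod.exhaust)
    have vm: "v \<in> {..<n} \<rightarrow>\<^sub>E N" "m \<in> {..<n} \<rightarrow>\<^sub>E UNIV"
      using q by (auto simp: graft_index_def n)
    then have "v n = undefined" "m n = undefined" by (auto simp: PiE_def extensional_def)
    then show "(case case q of (p, w, y) \<Rightarrow> ((fst p)(n := w), (snd p)(n := y)) of
        (v, m) \<Rightarrow> ((v(n := undefined), m(n := undefined)), v n, m n)) = q"
      by (simp add: fun_upd_idem)
    show "(case q of (p, w, y) \<Rightarrow> ((fst p)(n := w), (snd p)(n := y))) \<in> graft_index (bs @ [b]) N \<nn>"
      using q mem_graft_index_snoc[OF n vm, of w y b \<nn>] by simp
  next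
    fix p assume p: "p \<in> graft_index (bs @ [b]) N \<nn>"
    obtain v m where [simp]: "p = (v, m)" by (cases p)
    show "(case case p of (v, m) \<Rightarrow> ((v(n := undefined), m(n := undefined)), v n, m n) of
        (p, w, y) \<Rightarrow> ((fst p)(n := w), (snd p)(n := y))) = p"
      by simp
    have "v \<in> insert n {..<n} \<rightarrow>\<^sub>E N" and "m \<in> insert n {..<n} \<rightarrow>\<^sub>E UNIV"
      using p by (simp_all add: graft_index_def n lessThan_Suc[symmetric])
    note vm' = this
    have vm: "v(n := undefined) \<in> {..<n} \<rightarrow>\<^sub>E N" "m(n := undefined) \<in> {..<n} \<rightarrow>\<^sub>E UNIV" "v n \<in> N"
      by (rule fun_upd_in_PiE[OF _ vm'(1)], simp, rule fun_upd_in_PiE[OF _ vm'(2)], simp,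
          rule PiE_mem[OF vm'(1)], simp)
    show "(case p of (v, m) \<Rightarrow> ((v(n := undefined), m(n := undefined)), v n, m n)) \<in> ?D"
      using p mem_graft_index_snoc[OF n vm, of "m n" b \<nn>] vm(3) by simp
  qed auto
  finally show ?thesis by (simp add: case_prod_unfold)
qed

text \<open>Each new derivative meets decorations already lowered by the earlier ones, so the
  binomials multiply to the multinomial coefficients. Earlier branches are frozen, so it never
  grafts onto them: successive derivatives give the simultaneous grafting.\<close>

lemma cprod_frozen:
  assumes s: "distinct_nodes s"
  shows "cprod dm (\<lambda>b. u (fst (fst b)) (snd b)) (mset bs) (frozen dm F u s G \<nn> (\<lambda>w. {#})) =
    (\<Sum>p\<in>graft_index bs (nodes s) \<nn>. graft_coeff (length bs) (nodes s) \<nn> p *\<^sub>R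
       frozen dm F u s G (graft_label (length bs) \<nn> p) (graft_branches bs p))"
proof (induction bs rule: rev_induct)
  case Nil
  \<comment> \<open>Without branches the only index is the pair of empty families, which are
    \<open>undefined\<close> everywhere.\<close>
  have "graft_index [] (nodes s) \<nn> = {(\<lambda>_. undefined, \<lambda>_. undefined)}"
    by (auto simp: graft_index_def less_eq_vec_def)
  note this [simp]
  show ?case
    by (simp add: graft_coeff_def graft_label_def graft_branches_def del: sum_constant)
next
  case (snoc b bs)
  let ?n = "length bs"
  let ?E = "frozen dm F u s G" and ?c = "graft_coeff ?n (nodes s) \<nn>" and ?h = "graft_label ?n \<nn>"
    and ?g = "graft_branches bs"
  have "cprod dm (\<lambda>b. u (fst (fst b)) (snd b)) (mset (bs @ [b])) (?E \<nn> (\<lambda>w. {#})) =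
      cderiv dm (fst b) (u (fst (fst b)) (snd b))
        (\<Sum>p\<in>graft_index bs (nodes s) \<nn>. ?c p *\<^sub>R ?E (?h p) (?g p))"
    by (simp add: cprod_add_mset snoc.IH)
  also have "\<dots> = (\<Sum>p\<in>graft_index bs (nodes s) \<nn>. ?c p *\<^sub>R
      (\<Sum>w\<in>nodes s. \<Sum>y | y \<le> ?h p w \<and> y \<le> snd (fst b). mbinom (?h p w) y *\<^sub>R
         ?E ((?h p)(w := ?h p w - y)) ((?g p)(w := add_mset ((fst (fst b), snd (fst b) - y), snd b) (?g p w)))))"
    by (simp only: linear_sum[OF linear_cderiv] linear_scale[OF linear_cderiv] cderiv_frozen[OF s])
  also have "\<dots> = (\<Sum>p\<in>graft_index (bs @ [b]) (nodes s) \<nn>. graft_coeff (Suc ?n) (nodes s) \<nn> p *\<^sub>R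
       ?E (graft_label (Suc ?n) \<nn> p) (graft_branches (bs @ [b]) p))"
    unfolding sum_graft_index_snoc[OF refl finite_nodes] scaleR_sum_right
  proof (intro sum.cong refl, clarify, intro sum.cong refl)
    fix v m w y
    assume w: "w \<in> nodes s" and y: "y \<in> {y. y \<le> ?h (v, m) w \<and> y \<le> snd (fst b)}"
    show "?c (v, m) *\<^sub>R mbinom (?h (v, m) w) y *\<^sub>R ?E ((?h (v, m))(w := ?h (v, m) w - y))
          ((?g (v, m))(w := add_mset ((fst (fst b), snd (fst b) - y), snd b) (?g (v, m) w))) =
        graft_coeff (Suc ?n) (nodes s) \<nn> (v(?n := w), m(?n := y)) *\<^sub>R
          ?E (graft_label (Suc ?n) \<nn> (v(?n := w), m(?n := y)))
            (graft_branches (bs @ [b]) (v(?n := w), m(?n := y)))"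
      unfolding graft_label_snoc graft_branches_snoc[OF refl]
      using y by (subst graft_coeff_snoc[OF finite_nodes w]) auto
  qed
  finally show ?case by simp
qed

section \<open>Linear extensions\<close>

definition lin_val :: "('a \<Rightarrow> real) \<Rightarrow> ('a \<Rightarrow>\<^sub>0 real) \<Rightarrow> real"
  where "lin_val \<phi> x = (\<Sum>a\<in>Poly_Mapping.keys x. Poly_Mapping.lookup x a * \<phi> a)"

lemma lin_val_superset:
  assumes "finite S" "Poly_Mapping.keys x \<subseteq> S"
  shows "lin_val \<phi> x = (\<Sum>a\<in>S. Poly_Mapping.lookup x a * \<phi> a)"
  unfolding lin_val_def by (rule sum.mono_neutral_left[OF assms]) (simp add: in_keys_iff)

lemma lookup_map_mult [simp]:
  "Poly_Mapping.lookup (Poly_Mapping.map ((*) (q :: real)) p) a = q * Poly_Mapping.lookup p a"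
  by (simp add: map.rep_eq when_def)

lemma lin_val_0 [simp]: "lin_val \<phi> 0 = 0"
  by (simp add: lin_val_def)

lemma lin_val_add: "lin_val \<phi> (x + y) = lin_val \<phi> x + lin_val \<phi> y"
proof -
  let ?S = "Poly_Mapping.keys x \<union> Poly_Mapping.keys y"
  have "lin_val \<phi> z = (\<Sum>a\<in>?S. Poly_Mapping.lookup z a * \<phi> a)" if "z \<in> {x, y, x + y}" for z
    by (rule lin_val_superset) (use that keys_add[of x y] in auto)
  then show ?thesis by (simp add: lookup_add distrib_right sum.distrib)
qed

lemma lin_val_sum: "lin_val \<phi> (sum x J) = (\<Sum>j\<in>J. lin_val \<phi> (x j))"
  by (induction J rule: infinite_finite_induct) (simp_all add: lin_val_add)

lemma lin_val_single [simp]: "lin_val \<phi> (Poly_Mapping.single a q) = q * \<phi> a"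
  by (subst lin_val_superset[of "{a}"]) auto

lemma lin_val_map: "lin_val \<phi> (Poly_Mapping.map ((*) q) x) = q * lin_val \<phi> x"
proof -
  have "Poly_Mapping.keys (Poly_Mapping.map ((*) q) x) \<subseteq> Poly_Mapping.keys x"
    by (auto simp: in_keys_iff)
  from lin_val_superset[OF finite_keys this] show ?thesis
    by (simp add: lin_val_def sum_distrib_left mult.assoc)
qed

lemma lin_val_lin_ext: "lin_val \<phi> (lin_ext f x) = lin_val (\<lambda>a. lin_val \<phi> (f a)) x"
  by (simp add: lin_ext_def lin_val_sum lin_val_map lin_val_def[of "\<lambda>a. lin_val \<phi> (f a)"])

lemma lookup_lin_ext: "Poly_Mapping.lookup (lin_ext f x) b = lin_val (\<lambda>a. Poly_Mapping.lookup (f a) b) x"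
  by (simp add: lin_ext_def lin_val_def lookup_sum)

lemma lin_ext_0: "lin_ext f 0 = 0"
  by (simp add: lin_ext_def)

lemma lin_ext_add: "lin_ext f (x + y) = lin_ext f x + lin_ext f y"
  by (rule poly_mapping_eqI) (simp add: lookup_lin_ext lin_val_add lookup_add)

lemma lin_ext_single: "lin_ext f (Poly_Mapping.single a q) = Poly_Mapping.map ((*) q) (f a)"
  by (rule poly_mapping_eqI) (simp add: lookup_lin_ext)

text \<open>Two sums with the same coefficients over the same indices \<open>h\<close>, one of
  formal basis elements \<open>T h\<close> and one of vectors \<open>E h\<close>. As a relation it
  makes \<open>E h\<close> correspond to \<open>T h\<close> without inverting
  \<open>T\<close>.\<close>

inductive combination ::
    "('h \<Rightarrow> 'a) \<Rightarrow> ('h \<Rightarrow> 'b::real_vector) \<Rightarrow> ('a \<Rightarrow>\<^sub>0 real) \<Rightarrow> 'b \<Rightarrow> bool"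
  for T E where
    combination_0: "combination T E 0 0"
  | combination_add_single: "combination T E x y \<Longrightarrow>
      combination T E (x + Poly_Mapping.single (T h) q) (y + q *\<^sub>R E h)"

lemma combination_single: "combination T E (Poly_Mapping.single (T h) q) (q *\<^sub>R E h)"
  using combination_add_single[OF combination_0, of T E h q] by simp

lemma combination_add:
  assumes "combination T E x y" "combination T E x' y'"
  shows "combination T E (x + x') (y + y')"
  using assms(2,1)
  by (induction) (auto simp: add.assoc[symmetric] intro: combination_add_single)

lemma combination_sum:
  "(\<And>j. j \<in> J \<Longrightarrow> combination T E (x j) (y j)) \<Longrightarrow> combination T E (sum x J) (sum y J)"
  by (induction J rule: infinite_finite_induct) (auto intro: combination_0 combination_add)

lemma combination_lin_val:
  assumes "combination T E x y" "linear L" "\<And>h. \<phi> (T h) = L (E h)"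
  shows "lin_val \<phi> x = L y"
  using assms(1)
  by induction (simp_all add: linear_0[OF assms(2)] linear_add[OF assms(2)] linear_scale[OF assms(2)]
      lin_val_add assms(3))

section \<open>The star product on trees\<close>

lemma relabel_Node: "relabel f (Node x l M) = Node (f x) l (image_mset (map_prod id (relabel f)) M)"
  by (simp add: id_def)

lemma relabel_decorate_graft:
  "relabel f (decorate_graft h g s) =
    decorate_graft (\<lambda>w. f (h w)) (\<lambda>w. image_mset (map_prod id (relabel f)) (g w)) s"
proof (induction s)
  case (Node v l M)
  have "image_mset (map_prod id (relabel f)) (image_mset (map_prod id (decorate_graft h g)) M) =
      image_mset (map_prod id (decorate_graft (\<lambda>w. f (h w)) (\<lambda>w. image_mset (map_prod id (relabel f)) (g w)))) M"
    unfolding multiset.map_comp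
  proof (rule image_mset_cong)
    fix b assume b: "b \<in># M"
    have "relabel f (decorate_graft h g (snd b)) =
        decorate_graft (\<lambda>w. f (h w)) (\<lambda>w. image_mset (map_prod id (relabel f)) (g w)) (snd b)"
      by (rule Node.IH[OF b]) (simp add: snds.simps)
    then show "(map_prod id (relabel f) \<circ> map_prod id (decorate_graft h g)) b =
        map_prod id (decorate_graft (\<lambda>w. f (h w)) (\<lambda>w. image_mset (map_prod id (relabel f)) (g w))) b"
      by (cases b) simp
  qed
  then show ?case by (simp only: decorate_graft.simps relabel_Node image_mset_union)
qed

lemma relabel_eq_decorate_graft: "relabel f s = decorate_graft f (\<lambda>w. {#}) s"
proof (induction s)
  case (Node v l M)
  have "image_mset (map_prod id (relabel f)) M = image_mset (map_prod id (decorate_graft f (\<lambda>w. {#}))) M"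
  proof (rule image_mset_cong)
    fix b assume b: "b \<in># M"
    show "map_prod id (relabel f) b = map_prod id (decorate_graft f (\<lambda>w. {#})) b"
      using Node.IH[OF b, of "snd b"] by (cases b) (simp add: snds.simps)
  qed
  then show ?case by (simp add: relabel_Node del: tree.map)
qed

text \<open>The tree belonging to the index \<open>(h, g)\<close> of \<open>frozen\<close>. The
  marks keep nodes apart whose decorations coincide.\<close>

definition marked ::
    "(nat, 'n, ('k, 'd) edge) tree \<Rightarrow>
     (nat \<Rightarrow> 'd::finite midx) \<times> (nat \<Rightarrow> (('k, 'd) edge \<times> ('d, 'n, 'k) dtree) multiset) \<Rightarrow> ('d, 'n, 'k) marked_tree"
  where "marked s = (\<lambda>(h, g). decorate_graft (\<lambda>w. (Some w, h w))
    (\<lambda>w. image_mset (map_prod id (relabel (\<lambda>k. (None, k)))) (g w)) s)"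

lemma relabel_snd_marked:
  fixes s :: "(nat, 'n, ('k, 'd::finite) edge) tree"
  shows "relabel snd (marked s (h, g)) = decorate_graft h g s"
proof -
  have "relabel snd \<circ> (relabel (\<lambda>k. (None, k)) :: ('d, 'n, 'k) dtree \<Rightarrow> ('d, 'n, 'k) marked_tree) = id"
    by (simp add: fun_eq_iff tree.map_comp comp_def tree.map_ident)
  then show ?thesis
    by (simp add: marked_def relabel_decorate_graft multiset.map_comp map_prod_compose[symmetric] prod.map_id0)
qed

text \<open>Nodes of grafted trees carry \<open>None\<close> and so never match
  \<open>Some w\<close>.\<close>

lemma raise_marked:
  fixes s :: "(nat, 'n, ('k, 'd::finite) edge) tree"
  shows "relabel (\<lambda>(u, k). (u, if u = Some w then k + axis r 1 else k)) (marked s (h, g)) =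
    marked s (h(w := h w + axis r 1), g)"
proof -
  have "relabel (\<lambda>(u, k). (u, if u = Some w then k + axis r 1 else k)) (relabel (\<lambda>k. (None, k)) \<sigma>) =
      relabel (\<lambda>k. (None, k)) \<sigma>" for \<sigma> :: "('d, 'n, 'k) dtree"
    by (simp add: tree.map_comp comp_def)
  then have "relabel (\<lambda>(u, k). (u, if u = Some w then k + axis r 1 else k)) \<circ> relabel (\<lambda>k. (None, k)) =
      (relabel (\<lambda>k. (None, k)) :: ('d, 'n, 'k) dtree \<Rightarrow> ('d, 'n, 'k) marked_tree)"
    by (simp add: fun_eq_iff)
  moreover have "(\<lambda>w'. (Some w', if w' = w then h w' + axis r 1 else h w')) = (\<lambda>w'. (Some w', (h(w := h w + axis r 1)) w'))"
    by auto
  ultimately show ?thesis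
    by (simp add: marked_def relabel_decorate_graft multiset.map_comp map_prod_compose[symmetric])
qed

text \<open>Raising a marked tree and differentiating its frozen function give sums over the same
  nodes with the same new decorations.\<close>

lemma combination_raise:
  assumes s: "distinct_nodes s"
    and "combination (marked s) (\<lambda>(h, g). frozen dm F u s G h g) x y"
  shows "combination (marked s) (\<lambda>(h, g). frozen dm F u s G h g) (raise (nodes s) r x) (tderiv dm r y)"
  using assms(2)
proof induction
  case combination_0
  then show ?case
    by (simp add: raise_def lin_ext_0 linear_0[OF linear_tderiv] combination.combination_0)
next
  case (combination_add_single x y p q)
  obtain h g where p: "p = (h, g)" by (cases p)
  have "raise (nodes s) r (Poly_Mapping.single (marked s (h, g)) q) =
      (\<Sum>w\<in>nodes s. Poly_Mapping.single (marked s (h(w := h w + axis r 1), g)) q)"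
    unfolding raise_def lin_ext_single raise_marked
    by (rule poly_mapping_eqI) (simp add: lookup_sum lookup_single sum_distrib_left when_def if_distrib cong: if_cong)
  moreover have "tderiv dm r (q *\<^sub>R frozen dm F u s G h g) =
      (\<Sum>w\<in>nodes s. q *\<^sub>R frozen dm F u s G (h(w := h w + axis r 1)) g)"
    by (simp add: linear_scale[OF linear_tderiv] tderiv_frozen[OF s] scaleR_sum_right)
  moreover have "combination (marked s) (\<lambda>(h, g). frozen dm F u s G h g)
      (Poly_Mapping.single (marked s (h', g)) q) (q *\<^sub>R frozen dm F u s G h' g)" for h'
    using combination_single[of "marked s" "\<lambda>(h, g). frozen dm F u s G h g" "(h', g)" q] by simp
  ultimately have "combination (marked s) (\<lambda>(h, g). frozen dm F u s G h g)
      (raise (nodes s) r (Poly_Mapping.single (marked s (h, g)) q)) (tderiv dm r (q *\<^sub>R frozen dm F u s G h g))"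
    by (simp add: combination_sum)
  from combination_add[OF combination_add_single.IH this] show ?case
    by (simp add: p raise_def lin_ext_add linear_add[OF linear_tderiv])
qed

lemma grafted_eq_marked:
  "grafted bs s \<nn> v m = marked s (graft_label (length bs) \<nn> (v, m), graft_branches bs (v, m))"
  unfolding grafted_def marked_def graft_label_def graft_branches_def case_prod_conv multiset.map_comp
  by (simp add: comp_def case_prod_unfold)

lemma graft_eq_sum:
  fixes bs :: "(('k, 'd::finite) edge \<times> ('d, 'n, 'k) dtree) list"
  shows "graft bs s \<nn> = (\<Sum>p\<in>graft_index bs (nodes s) \<nn>.
    Poly_Mapping.single (marked s (graft_label (length bs) \<nn> p, graft_branches bs p))
      (graft_coeff (length bs) (nodes s) \<nn> p))"
proof -
  let ?n = "length bs"
  let ?V = "{..<?n} \<rightarrow>\<^sub>E nodes s"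
  let ?M = "\<lambda>v. {m \<in> {..<?n} \<rightarrow>\<^sub>E UNIV. \<forall>w\<in>nodes s. (\<Sum>i | i < ?n \<and> v i = w. m i) \<le> \<nn> w}"
  let ?f = "\<lambda>p. Poly_Mapping.single (marked s (graft_label ?n \<nn> p, graft_branches bs p))
      (graft_coeff ?n (nodes s) \<nn> p)"
  have finV: "finite ?V" by (simp add: finite_PiE)
  \<comment> \<open>Each \<open>m i\<close> is one term of the sum bounded by the decoration of its
    target node.\<close>
  have finM: "finite (?M v)" if v: "v \<in> ?V" for v
  proof (rule finite_subset)
    show "finite (PiE {..<?n} (\<lambda>i. {k. k \<le> \<nn> (v i)}))"
      by (intro finite_PiE finite_lessThan finite_midx_le)
    show "?M v \<subseteq> PiE {..<?n} (\<lambda>i. {k. k \<le> \<nn> (v i)})"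
    proof
      fix m assume m: "m \<in> ?M v"
      have "m i \<le> \<nn> (v i)" if i: "i < ?n" for i
      proof -
        have "m i $ r \<le> (\<Sum>j | j < ?n \<and> v j = v i. m j) $ r" for r
          using i by (auto simp: sum_component intro!: member_le_sum)
        moreover have "(\<Sum>j | j < ?n \<and> v j = v i. m j) \<le> \<nn> (v i)"
          using m PiE_mem[OF v, of i] i by auto
        ultimately show ?thesis
          unfolding less_eq_vec_def by (meson order_trans)
      qed
      then show "m \<in> PiE {..<?n} (\<lambda>i. {k. k \<le> \<nn> (v i)})"
        using m unfolding PiE_def Pi_def by blast
    qed
  qed
  have "graft bs s \<nn> = (\<Sum>v\<in>?V. \<Sum>m\<in>?M v. if \<forall>i<?n. m i \<le> snd (fst (bs ! i)) then ?f (v, m) else 0)"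
    unfolding graft_def grafted_eq_marked graft_coeff_def case_prod_conv ..
  also have "\<dots> = (\<Sum>(v, m)\<in>Sigma ?V ?M. if \<forall>i<?n. m i \<le> snd (fst (bs ! i)) then ?f (v, m) else 0)"
    by (rule sum.Sigma[OF finV]) (use finM in blast)
  also have "\<dots> = (\<Sum>p\<in>graft_index bs (nodes s) \<nn>. ?f p)"
  proof (rule sum.mono_neutral_cong_right)
    show "finite (Sigma ?V ?M)" by (rule finite_SigmaI[OF finV finM])
  qed (auto simp: graft_index_def split: if_splits)
  finally show ?thesis .
qed

lemma combination_graft:
  assumes s: "distinct_nodes s"
  shows "combination (marked s) (\<lambda>(h, g). frozen dm F u s G h g) (graft bs s \<nn>)
    (cprod dm (\<lambda>b. u (fst (fst b)) (snd b)) (mset bs) (frozen dm F u s G \<nn> (\<lambda>w. {#})))"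
  unfolding graft_eq_sum cprod_frozen[OF s]
proof (rule combination_sum)
  fix p
  show "combination (marked s) (\<lambda>(h, g). frozen dm F u s G h g)
      (Poly_Mapping.single (marked s (graft_label (length bs) \<nn> p, graft_branches bs p))
        (graft_coeff (length bs) (nodes s) \<nn> p))
      (graft_coeff (length bs) (nodes s) \<nn> p *\<^sub>R
        frozen dm F u s G (graft_label (length bs) \<nn> p) (graft_branches bs p))"
    using combination_single[of "marked s" "\<lambda>(h, g). frozen dm F u s G h g"
        "(graft_label (length bs) \<nn> p, graft_branches bs p)"] by simp
qed

lemma linear_Rep_sfun: "linear (\<lambda>G. Rep_sfun G Z)"
  by (rule linearI) (simp_all add: plus_sfun.rep_eq Rep_sfun_scaleR)

lemma elem_diff_star_tree:
  fixes dm :: "'k \<Rightarrow> nat" and \<tau> :: "('d::{finite,linorder}, 'n, 'k) dtree"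
  assumes F': "\<And>i l c. c < dm i \<Longrightarrow> Rep_sfun (F' i l c) = F i l c" and c: "c < dm i"
  obtains G where "\<And>Z. elem_diff dm F \<tau> i c Z = Rep_sfun G Z"
    and "\<And>k bs Z. lin_val (\<lambda>t. elem_diff dm F t i c Z) (star_tree (Node k None (mset bs)) \<tau>) =
      Rep_sfun (tpow dm k (cprod dm (\<lambda>b c. elem_diff dm F (snd b) (fst (fst b)) c Z) (mset bs) G)) Z"
proof -
  obtain s \<nn> where SOME: "(SOME (s, \<nn>). presents s \<nn> \<tau>) = (s, \<nn>)"
    by (cases "SOME (s, \<nn>). presents s \<nn> \<tau>")
  have "presents s \<nn> \<tau>"
    using someI_ex[of "\<lambda>(s, \<nn>). presents s \<nn> \<tau>"] ex_presents[of \<tau>] SOME by auto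
  then have s: "distinct_nodes s" and \<tau>: "\<tau> = decorate_graft \<nn> (\<lambda>w. {#}) s"
    by (auto simp: presents_def distinct_nodes_def relabel_eq_decorate_graft)
  have ed: "elem_diff dm F (decorate_graft h g s) i c Z =
      Rep_sfun (frozen dm F' (\<lambda>j t c. elem_diff dm F t j c Z) s (F' i (root_noise s) c) h g) Z" for h g Z
    unfolding frozen_def by (rule elem_diff_decorate_graft[where F = F and F' = F' and dm = dm]) (use F' c in auto)
  define G where "G = rop dm F' (\<lambda>w. tpow dm (\<nn> w)) s (F' i (root_noise s) c)"
  show thesis
  proof (rule that)
    show "elem_diff dm F \<tau> i c Z = Rep_sfun G Z" for Z
      unfolding \<tau> ed by (simp add: frozen_def G_def)
    fix k :: "'d midx" and bs :: "(('k, 'd) edge \<times> ('d, 'n, 'k) dtree) list" and Z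
    let ?u = "\<lambda>j t c. elem_diff dm F t j c Z"
    let ?E = "frozen dm F' ?u s (F' i (root_noise s) c)"
    let ?P = "cprod dm (\<lambda>b c. elem_diff dm F (snd b) (fst (fst b)) c Z) (mset bs) G"
    \<comment> \<open>With no grafted branches nothing is frozen, so this function is the same for
      every \<open>Z\<close>.\<close>
    have G: "?E \<nn> (\<lambda>w. {#}) = G"
      by (simp add: frozen_def G_def)
    have "combination (marked s) (\<lambda>(h, g). ?E h g)
        (multi_power (raise (nodes s)) k (graft (enum_mset (mset bs)) s \<nn>)) (tpow dm k ?P)"
      unfolding tpow_def
      by (rule multi_power_rel[where R = "combination (marked s) (\<lambda>(h, g). ?E h g)"], erule combination_raise[OF s])
        (use combination_graft[OF s, of dm F' ?u "F' i (root_noise s) c" "enum_mset (mset bs)" \<nn>] G in simp)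
    then have "lin_val (\<lambda>t. elem_diff dm F (relabel snd t) i c Z)
        (multi_power (raise (nodes s)) k (graft (enum_mset (mset bs)) s \<nn>)) = Rep_sfun (tpow dm k ?P) Z"
    proof (rule combination_lin_val[OF _ linear_Rep_sfun])
      show "elem_diff dm F (relabel snd (marked s p)) i c Z = Rep_sfun (case p of (h, g) \<Rightarrow> ?E h g) Z" for p
        by (cases p) (simp add: relabel_snd_marked ed)
    qed
    then show "lin_val (\<lambda>t. elem_diff dm F t i c Z) (star_tree (Node k None (mset bs)) \<tau>) =
        Rep_sfun (tpow dm k ?P) Z"
      by (simp add: SOME lin_val_lin_ext)
  qed
qed

theorem proposition2:
  fixes dm :: "'k::finite \<Rightarrow> nat"
    and F :: "'k \<Rightarrow> 'n::finite option \<Rightarrow> nat \<Rightarrow> ('k, 'd::{finite,linorder}) point \<Rightarrow> real"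
    and \<sigma> :: "('d, 'n, 'k) dtree \<Rightarrow>\<^sub>0 real"
    and k :: "'d midx"
    and bs :: "(('k, 'd) edge \<times> ('d, 'n, 'k) dtree) list"
    and i :: 'k and c :: nat and Z :: "('k, 'd) point"
  assumes "CARD('d) \<ge> 2"
    and "\<And>j. dm j \<ge> 1"
    and "\<And>j l c. c < dm j \<Longrightarrow> smooth (F j l c)"
    and "\<And>j l c. c < dm j \<Longrightarrow> finitely_many_vars dm (F j l c)"
    and "c < dm i"
  shows "elem_diff_lin dm F (Poly_Mapping.single (Node k None (mset bs)) 1 \<star> \<sigma>) i c Z =
    deriv_eval dm k (map (\<lambda>(a, \<tau>). (a, elem_diff dm F \<tau> (fst a))) bs) (elem_diff_lin dm F \<sigma> i c) Z"
proof -
  \<comment> \<open>Outside \<open>c < dm i\<close> the value is unspecified; the sums in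
    \<open>rop\<close> only use components in range.\<close>
  define F' where "F' i l c = Abs_sfun (F i l c)" for i l c
  have F': "Rep_sfun (F' i l c) = F i l c" if c: "c < dm i" for i l c
  proof -
    obtain S where "finite S" "\<forall>Z Z'. (\<forall>(a, c)\<in>S. Z a c = Z' a c) \<longrightarrow> F i l c Z = F i l c Z'"
      using assms(4)[OF c, of l] unfolding finitely_many_vars_def by blast
    then have "F i l c \<in> sfuns"
      using assms(3)[OF c] unfolding sfuns_def depends_on_def by blast
    then show ?thesis
      by (simp add: F'_def Abs_sfun_inverse)
  qed
  let ?u = "\<lambda>b c. elem_diff dm F (snd b) (fst (fst b)) c Z"
  have "\<exists>G. (\<forall>Z. elem_diff dm F \<tau> i c Z = Rep_sfun G Z) \<and>
      lin_val (\<lambda>t. elem_diff dm F t i c Z) (star_tree (Node k None (mset bs)) \<tau>) =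
        Rep_sfun (tpow dm k (cprod dm ?u (mset bs) G)) Z" for \<tau>
    by (rule elem_diff_star_tree[of dm F' F c i \<tau>, OF F' assms(5)]) blast+
  then obtain G where G: "\<And>\<tau> Z. elem_diff dm F \<tau> i c Z = Rep_sfun (G \<tau>) Z"
    "\<And>\<tau>. lin_val (\<lambda>t. elem_diff dm F t i c Z) (star_tree (Node k None (mset bs)) \<tau>) =
        Rep_sfun (tpow dm k (cprod dm ?u (mset bs) (G \<tau>))) Z"
    by metis
  \<comment> \<open>A single function for the whole linear combination; linearity of
    \<open>tpow\<close> and \<open>cprod\<close> extends the identity from trees to it.\<close>
  let ?H = "\<Sum>\<tau>\<in>Poly_Mapping.keys \<sigma>. Poly_Mapping.lookup \<sigma> \<tau> *\<^sub>R G \<tau>"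
  have H: "elem_diff_lin dm F \<sigma> i c = Rep_sfun ?H"
    by (simp add: fun_eq_iff elem_diff_lin_def G(1) Rep_sfun_sum Rep_sfun_scaleR)
  have "elem_diff_lin dm F (Poly_Mapping.single (Node k None (mset bs)) 1 \<star> \<sigma>) i c Z =
      lin_val (\<lambda>t. elem_diff dm F t i c Z) (Poly_Mapping.single (Node k None (mset bs)) 1 \<star> \<sigma>)"
    by (simp add: elem_diff_lin_def lin_val_def)
  also have "\<dots> = lin_val (\<lambda>\<tau>. lin_val (\<lambda>t. elem_diff dm F t i c Z) (star_tree (Node k None (mset bs)) \<tau>)) \<sigma>"
    by (simp add: star_def lin_val_lin_ext del: star_tree.simps)
  also have "\<dots> = Rep_sfun (tpow dm k (cprod dm ?u (mset bs) ?H)) Z"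
    unfolding G(2) by (simp add: lin_val_def linear_sum[OF linear_cprod] linear_sum[OF linear_tpow]
        linear_scale[OF linear_cprod] linear_scale[OF linear_tpow] Rep_sfun_sum Rep_sfun_scaleR)
  \<comment> \<open>The payloads change from trees to their vector-valued functions, the form
    required by \<open>deriv_eval_eq_cprod\<close>; at \<open>Z\<close> both give the same
    numbers.\<close>
  also have "cprod dm ?u (mset bs) ?H = cprod dm (\<lambda>b c. snd b c Z)
      (image_mset (\<lambda>(a, \<tau>). (a, elem_diff dm F \<tau> (fst a))) (mset bs)) ?H"
    by (rule cprod_image_mset[symmetric]) (simp_all add: case_prod_unfold)
  also have "Rep_sfun (tpow dm k \<dots>) Z =
      deriv_eval dm k (map (\<lambda>(a, \<tau>). (a, elem_diff dm F \<tau> (fst a))) bs) (elem_diff_lin dm F \<sigma> i c) Z"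
    by (simp add: H deriv_eval_eq_cprod)
  finally show ?thesis .
qed

end
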